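(* Let $A=(a_{i,j})$ be any $r\times r$ symmetrisable generalised Cartan matrix and $S=\mathbb{Z}_{>0}$. If $f\in\mathrm{Frieze}(A,S)$ is unitary, then $p_{A,S}(f)\in\mathrm{YFrieze}(A,S)$ is unitary, where $p_{A,S}(f)(i,m)=\prod_{j=i+1}^r f(j,m)^{-a_{j,i}}\prod_{j=1}^{i-1} f(j,m+1)^{-a_{j,i}}$.
   Context: A symmetrisable generalised Cartan matrix is an integer matrix $A=(a_{i,j})$ with $a_{i,i}=2$, $a_{i,j}\le0$ for $i\ne j$, $a_{i,j}=0$ iff $a_{j,i}=0$, and $DA$ symmetric for some positive diagonal $D$. A $\mathbb{Z}_{>0}$-valued frieze pattern (arithmetic frieze pattern) associated to $A$ is a map $f:[1,r]\times\mathbb{Z}\to\mathbb{Z}_{>0}$ with $f(i,m)f(i,m+1)=1+\prod_{j>i} f(j,m)^{-a_{j,i}}\prod_{j<i}f(j,m+1)^{-a_{j,i}}$ for all $(i,m)$; a $\mathbb{Z}_{>0}$-valued $\mathbf{Y}$-frieze pattern is a map $k:[1,r]\times\mathbb{Z}\to\mathbb{Z}_{>0}$ with $k(i,m)k(i,m+1)=\prod_{j>i}(1+k(j,m))^{-a_{j,i}}\prod_{j<i}(1+k(j,m+1))^{-a_{j,i}}$ for all $(i,m)$. $\mathrm{Frieze}(A,S)$, $\mathrm{YFrieze}(A,S)$ denote these sets. Cluster setup. A mutation matrix is a skew-symmetrisable $r\times r$ integer matrix; its mutation in direction $k$ is $\mu_k(B)=(b'_{i,j})$ with $b'_{i,j}=-b_{i,j}$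 if $i=k$ or $j=k$, and $b'_{i,j}=b_{i,j}+[b_{i,k}]_+[b_{k,j}]_+-[-b_{i,k}]_+[-b_{k,j}]_+$ otherwise ($[a]_+=\max(a,0)$). Let $\mathbb{T}_r$ be the $r$-regular tree with edges at each vertex labelled bijectively by $[1,r]$, with root $t_0$. Let $B=B_A$ be the matrix with $(B_A)_{i,j}=a_{i,j}$ for $i<j$, $(B_A)_{i,j}=-a_{i,j}$ for $i>j$, and $0$ on the diagonal. Let $\{B_t\}$ be the matrix pattern with $B_{t_0}=B$ and $B_{t'}=\mu_k(B_t)$ whenever $t,t'$ are joined by an edge labelled $k$. An $\mathbf{A}$-pattern is an assignment of $r$-tuples $\mathbf{x}_t=(x_{t;1},\dots,x_{t;r})$ of free generators of a rational function field in $r$ variables over $\mathbb{Q}$ such that, for an edge $t$—$t'$ labelled $k$, $\mathbf{x}_{t'}$ agrees with $\mathbf{x}_t$ except $x_{t';k}=\big(\prod_j x_{t;j}^{[b_{j,k}]_+}+\prod_j x_{t;j}^{[-b_{j,k}]_+}\big)/x_{t;k}$, where $(b_{j,k})=B_t$. A $\mathbf{Y}$-pattern is an assignment of $r$-tuples $\mathbf{y}_t$ of free generators of another rational function field with $y_{t';k}=y_{t;k}^{-1}$ and $y_{t';j}=y_{t;j}y_{t;k}^{[b_{k,j}]_+}(1+y_{t;k})^{-b_{k,j}}$ for $j\ne k$, $(b_{i,j})=B_t$. The tuples $\mathbf{x}_t$ are the clusters and $\mathbf{y}_t$ the $\mathbf{Y}$-clusters. Define vertices $t(i,m)$, $(i,m)\in[1,r]\times\mathbb{Z}$,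 by $t(1,0)=t_0$, $t(i,m)$ and $t(i+1,m)$ joined by the edge labelled $i$ ($i<r$), and $t(r,m)$ and $t(1,m+1)$ joined by the edge labelled $r$. Set $x(i,m)=x_{t(i,m);i}$ and $y(i,m)=y_{t(i,m);i}$. For every vertex $t$, each $x(i,m)$ is a Laurent polynomial in $\mathbf{x}_t$ and each $y(i,m)$ is a Laurent polynomial in $\mathbf{y}_t$ (with integer coefficients). For a cluster $\mathbf{x}$ let $\psi_{\mathbf{x}}:\mathbb{Z}[\mathbf{x}^{\pm1}]\to\mathbb{Z}$ be the ring homomorphism sending each variable of $\mathbf{x}$ to $1$; similarly $\phi_{\mathbf{y}}$ for a $\mathbf{Y}$-cluster $\mathbf{y}$. An arithmetic frieze pattern $f$ is unitary if there is a cluster $\mathbf{x}$ with $f(i,m)=\psi_{\mathbf{x}}(x(i,m))$ for all $(i,m)$; an arithmetic $\mathbf{Y}$-frieze pattern $k$ is unitary if there is a $\mathbf{Y}$-cluster $\mathbf{y}$ with $k(i,m)=\phi_{\mathbf{y}}(y(i,m))$ for all $(i,m)$ (these maps are indeed arithmetic frieze / $\mathbf{Y}$-frieze patterns). *)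

theory Defs
  imports Complex_Main "HOL-Library.Poly_Mapping"
begin

text \<open>
  An \<open>r \<times> r\<close> matrix is a function \<open>nat \<Rightarrow> nat \<Rightarrow> int\<close> of which only the entries with both
  indices in \<open>{1..r}\<close> are relevant.  Likewise an \<open>r\<close>-tuple is a function on \<open>nat\<close> read on
  \<open>{1..r}\<close>, and a pattern on \<open>[1,r] \<times> \<int>\<close> is a function \<open>nat \<Rightarrow> int \<Rightarrow> int\<close>.
  For \<open>b :: int\<close> the natural number \<open>nat b\<close> is \<open>[b]\<^sub>+ = max b 0\<close>.
\<close>

definition symmetrisable_gcm :: "nat \<Rightarrow> (nat \<Rightarrow> nat \<Rightarrow> int) \<Rightarrow> bool" where
  "symmetrisable_gcm r A \<longleftrightarrow>
     (\<forall>i\<in>{1..r}. A i i = 2) \<and>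
     (\<forall>i\<in>{1..r}. \<forall>j\<in>{1..r}. i \<noteq> j \<longrightarrow> A i j \<le> 0) \<and>
     (\<forall>i\<in>{1..r}. \<forall>j\<in>{1..r}. A i j = 0 \<longleftrightarrow> A j i = 0) \<and>
     (\<exists>d :: nat \<Rightarrow> real. (\<forall>i\<in>{1..r}. d i > 0) \<and>
        (\<forall>i\<in>{1..r}. \<forall>j\<in>{1..r}. d i * of_int (A i j) = d j * of_int (A j i)))"


section \<open>Friezes and Y-friezes with values in the positive integers\<close>

definition Frieze :: "nat \<Rightarrow> (nat \<Rightarrow> nat \<Rightarrow> int) \<Rightarrow> (nat \<Rightarrow> int \<Rightarrow> int) set" where
  "Frieze r A = {f. \<forall>i\<in>{1..r}. \<forall>m. f i m > 0 \<and>
     f i m * f i (m + 1) =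
       1 + (\<Prod>j\<in>{i<..r}. f j m ^ nat (- A j i)) * (\<Prod>j\<in>{1..<i}. f j (m + 1) ^ nat (- A j i))}"

definition YFrieze :: "nat \<Rightarrow> (nat \<Rightarrow> nat \<Rightarrow> int) \<Rightarrow> (nat \<Rightarrow> int \<Rightarrow> int) set" where
  "YFrieze r A = {k. \<forall>i\<in>{1..r}. \<forall>m. k i m > 0 \<and>
     k i m * k i (m + 1) =
       (\<Prod>j\<in>{i<..r}. (1 + k j m) ^ nat (- A j i)) *
       (\<Prod>j\<in>{1..<i}. (1 + k j (m + 1)) ^ nat (- A j i))}"

definition p_map :: "nat \<Rightarrow> (nat \<Rightarrow> nat \<Rightarrow> int) \<Rightarrow> (nat \<Rightarrow> int \<Rightarrow> int) \<Rightarrow> (nat \<Rightarrow> int \<Rightarrow> int)" where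
  "p_map r A f i m =
     (\<Prod>j\<in>{i<..r}. f j m ^ nat (- A j i)) * (\<Prod>j\<in>{1..<i}. f j (m + 1) ^ nat (- A j i))"


section \<open>The regular tree\<close>

text \<open>
  The vertices of \<open>\<bbbT>\<^sub>r\<close> are the words over \<open>{1..r}\<close> without equal adjacent letters: a word lists
  the edge labels on the path from the vertex (head of the list) back to the root \<open>[]\<close>.
  The edge labelled \<open>k\<close> at \<open>t\<close> joins \<open>t\<close> to \<open>neighbour t k\<close>.
\<close>

definition tree_vertices :: "nat \<Rightarrow> nat list set" where
  "tree_vertices r = {t. set t \<subseteq> {1..r} \<and> distinct_adj t}"

definition neighbour :: "nat list \<Rightarrow> nat \<Rightarrow> nat list" where
  "neighbour t k = (if t \<noteq> [] \<and> hd t = k then tl t else k # t)"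

lemma neighbour_in_tree:
  assumes "t \<in> tree_vertices r" "k \<in> {1..r}"
  shows "neighbour t k \<in> tree_vertices r"
  using assms by (cases t) (auto simp: tree_vertices_def neighbour_def distinct_adj_Cons)

lemma neighbour_neighbour:
  assumes "t \<in> tree_vertices r"
  shows "neighbour (neighbour t k) k = t"
proof (cases t)
  case (Cons a s)
  then show ?thesis
    using assms by (cases s) (auto simp: tree_vertices_def neighbour_def)
qed (simp add: neighbour_def)


section \<open>Matrix, A- and Y-patterns\<close>

definition mutate :: "nat \<Rightarrow> (nat \<Rightarrow> nat \<Rightarrow> int) \<Rightarrow> (nat \<Rightarrow> nat \<Rightarrow> int)" where
  "mutate k B i j =
     (if i = k \<or> j = k then - B i j
      else B i j + max (B i k) 0 * max (B k j) 0 - max (- B i k) 0 * max (- B k j) 0)"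

lemma mutate_mutate: "mutate k (mutate k B) = B"
  by (intro ext) (auto simp: mutate_def)

definition B_init :: "(nat \<Rightarrow> nat \<Rightarrow> int) \<Rightarrow> (nat \<Rightarrow> nat \<Rightarrow> int)" where
  "B_init A i j = (if i < j then A i j else if i > j then - A i j else 0)"

primrec B_at :: "(nat \<Rightarrow> nat \<Rightarrow> int) \<Rightarrow> nat list \<Rightarrow> (nat \<Rightarrow> nat \<Rightarrow> int)" where
  "B_at A [] = B_init A"
| "B_at A (k # t) = mutate k (B_at A t)"

lemma B_at_neighbour: "B_at A (neighbour t k) = mutate k (B_at A t)"
  by (cases t) (auto simp: neighbour_def mutate_mutate)

definition algebraically_independent :: "nat \<Rightarrow> (nat \<Rightarrow> 'a::field_char_0) \<Rightarrow> bool" where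
  "algebraically_independent r u \<longleftrightarrow>
     (\<forall>P :: (nat \<Rightarrow>\<^sub>0 nat) \<Rightarrow>\<^sub>0 rat.
        (\<forall>\<mu>\<in>Poly_Mapping.keys P. Poly_Mapping.keys \<mu> \<subseteq> {1..r}) \<longrightarrow>
        (\<Sum>\<mu>\<in>Poly_Mapping.keys P.
           of_rat (Poly_Mapping.lookup P \<mu>) * (\<Prod>i\<in>{1..r}. u i ^ Poly_Mapping.lookup \<mu> i)) = 0 \<longrightarrow>
        P = 0)"

text \<open>The smallest subfield containing the \<open>u i\<close>; in characteristic 0 this is \<open>\<rat>(u\<^sub>1,\<dots>,u\<^sub>r)\<close>.\<close>

inductive_set generated_field :: "nat \<Rightarrow> (nat \<Rightarrow> 'a::field_char_0) \<Rightarrow> 'a set"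
  for r :: nat and u :: "nat \<Rightarrow> 'a" where
  one: "1 \<in> generated_field r u"
| gen: "i \<in> {1..r} \<Longrightarrow> u i \<in> generated_field r u"
| diff: "a \<in> generated_field r u \<Longrightarrow> b \<in> generated_field r u \<Longrightarrow> a - b \<in> generated_field r u"
| mult: "a \<in> generated_field r u \<Longrightarrow> b \<in> generated_field r u \<Longrightarrow> a * b \<in> generated_field r u"
| inverse: "a \<in> generated_field r u \<Longrightarrow> inverse a \<in> generated_field r u"

definition free_generators :: "nat \<Rightarrow> 'a::field_char_0 set \<Rightarrow> (nat \<Rightarrow> 'a) \<Rightarrow> bool" where
  "free_generators r F u \<longleftrightarrow> algebraically_independent r u \<and> generated_field r u = F"

text \<open>
  The rational function field \<open>F\<close> is a subfield of the ambient field \<open>'a\<close>, so that the ambient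
  type need not depend on \<open>r\<close>.
\<close>

definition A_pattern ::
    "nat \<Rightarrow> (nat \<Rightarrow> nat \<Rightarrow> int) \<Rightarrow> (nat list \<Rightarrow> nat \<Rightarrow> 'a::field_char_0) \<Rightarrow> bool" where
  "A_pattern r A x \<longleftrightarrow>
     (\<exists>F. \<forall>t\<in>tree_vertices r. free_generators r F (x t)) \<and>
     (\<forall>t\<in>tree_vertices r. \<forall>k\<in>{1..r}.
        (\<forall>j\<in>{1..r} - {k}. x (neighbour t k) j = x t j) \<and>
        x (neighbour t k) k =
          ((\<Prod>j\<in>{1..r}. x t j ^ nat (B_at A t j k)) +
           (\<Prod>j\<in>{1..r}. x t j ^ nat (- B_at A t j k))) / x t k)"

definition Y_pattern ::
    "nat \<Rightarrow> (nat \<Rightarrow> nat \<Rightarrow> int) \<Rightarrow> (nat list \<Rightarrow> nat \<Rightarrow> 'a::field_char_0) \<Rightarrow> bool" where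
  "Y_pattern r A y \<longleftrightarrow>
     (\<exists>F. \<forall>t\<in>tree_vertices r. free_generators r F (y t)) \<and>
     (\<forall>t\<in>tree_vertices r. \<forall>k\<in>{1..r}.
        y (neighbour t k) k = inverse (y t k) \<and>
        (\<forall>j\<in>{1..r} - {k}. y (neighbour t k) j =
           y t j * y t k ^ nat (B_at A t k j) * (1 + y t k) powi (- B_at A t k j)))"


section \<open>The acyclic belt\<close>

text \<open>
  The vertices \<open>t(i,m)\<close> form a walk indexed by \<open>n = m r + (i - 1) \<in> \<int>\<close>, whose step from
  \<open>n\<close> to \<open>n + 1\<close> is along the edge labelled \<open>(n mod r) + 1\<close>.  The lemmas \<open>belt_start\<close>,
  \<open>belt_step\<close> and \<open>belt_wrap\<close> are the defining properties of the \<open>t(i,m)\<close>.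
\<close>

primrec belt_forward :: "nat \<Rightarrow> nat \<Rightarrow> nat list" where
  "belt_forward r 0 = []"
| "belt_forward r (Suc n) = neighbour (belt_forward r n) (nat (int n mod int r) + 1)"

primrec belt_backward :: "nat \<Rightarrow> nat \<Rightarrow> nat list" where
  "belt_backward r 0 = []"
| "belt_backward r (Suc n) = neighbour (belt_backward r n) (nat (- int (Suc n) mod int r) + 1)"

definition belt_walk :: "nat \<Rightarrow> int \<Rightarrow> nat list" where
  "belt_walk r n = (if n \<ge> 0 then belt_forward r (nat n) else belt_backward r (nat (- n)))"

definition belt :: "nat \<Rightarrow> nat \<Rightarrow> int \<Rightarrow> nat list" where
  "belt r i m = belt_walk r (m * int r + int i - 1)"

lemma belt_label_in:
  assumes "r \<ge> 1"
  shows "nat (n mod int r) + 1 \<in> {1..r}"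
proof -
  have "0 \<le> n mod int r" "n mod int r < int r"
    using assms by simp_all
  then show ?thesis by auto
qed

lemma belt_walk_in_tree:
  assumes "r \<ge> 1"
  shows "belt_walk r n \<in> tree_vertices r"
proof -
  have "[] \<in> tree_vertices r" by (simp add: tree_vertices_def)
  then have "belt_forward r k \<in> tree_vertices r" "belt_backward r k \<in> tree_vertices r" for k
    using assms
    by (induction k) (simp_all only: belt_forward.simps belt_backward.simps
      neighbour_in_tree belt_label_in)
  then show ?thesis by (simp add: belt_walk_def)
qed

lemma belt_walk_step:
  assumes "r \<ge> 1"
  shows "belt_walk r (n + 1) = neighbour (belt_walk r n) (nat (n mod int r) + 1)"
proof (cases "n \<ge> 0")
  case True
  then have "nat (n + 1) = Suc (nat n)" by simp
  with True show ?thesis by (simp add: belt_walk_def)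
next
  case False
  define k where "k = nat (- (n + 1))"
  have k: "nat (- n) = Suc k" "- int (Suc k) = n" using False by (auto simp: k_def)
  have next_eq: "belt_walk r (n + 1) = belt_backward r k"
  proof (cases "n + 1 = 0")
    case True
    then show ?thesis by (simp add: belt_walk_def k_def)
  next
    case ne: False
    with False show ?thesis by (simp add: belt_walk_def k_def)
  qed
  have "belt_walk r n = belt_backward r (Suc k)"
    using False k(1) by (simp add: belt_walk_def)
  also have "\<dots> = neighbour (belt_walk r (n + 1)) (nat (n mod int r) + 1)"
    by (simp only: belt_backward.simps k(2) next_eq)
  finally show ?thesis
    using neighbour_neighbour[OF belt_walk_in_tree[OF assms]] by simp
qed

lemma belt_start: "belt r 1 0 = []"
  by (simp add: belt_def belt_walk_def)

lemma belt_step: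
  assumes "1 \<le> i" "i < r"
  shows "belt r (i + 1) m = neighbour (belt r i m) i"
proof -
  have "(m * int r + int i - 1) mod int r = (int i - 1 + m * int r) mod int r"
    by (simp add: algebra_simps)
  also have "\<dots> = (int i - 1) mod int r" by (rule mod_mult_self1)
  also have "\<dots> = int i - 1" using assms by (intro mod_pos_pos_trivial) auto
  finally have lab: "nat ((m * int r + int i - 1) mod int r) + 1 = i" using assms by simp
  have "belt r (i + 1) m = belt_walk r ((m * int r + int i - 1) + 1)"
    by (simp add: belt_def)
  then show ?thesis
    using assms by (simp only: belt_walk_step lab belt_def)
qed

lemma belt_wrap:
  assumes "r \<ge> 1"
  shows "belt r 1 (m + 1) = neighbour (belt r r m) r"
proof -
  have "(m * int r + int r - 1) mod int r = (int r - 1 + m * int r) mod int r"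
    by (simp add: algebra_simps)
  also have "\<dots> = (int r - 1) mod int r" by (rule mod_mult_self1)
  also have "\<dots> = int r - 1" using assms by (intro mod_pos_pos_trivial) auto
  finally have lab: "nat ((m * int r + int r - 1) mod int r) + 1 = r" using assms by simp
  have "belt r 1 (m + 1) = belt_walk r ((m * int r + int r - 1) + 1)"
    by (simp add: belt_def algebra_simps)
  then show ?thesis
    using assms by (simp only: belt_walk_step lab belt_def)
qed


section \<open>Unitary patterns\<close>

text \<open>The subring \<open>\<int>[u\<^sub>1\<^sup>\<plusminus>, \<dots>, u\<^sub>r\<^sup>\<plusminus>]\<close> of the ambient field.\<close>

inductive_set laurent_ring :: "nat \<Rightarrow> (nat \<Rightarrow> 'a::field) \<Rightarrow> 'a set"
  for r :: nat and u :: "nat \<Rightarrow> 'a" where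
  one: "1 \<in> laurent_ring r u"
| gen: "i \<in> {1..r} \<Longrightarrow> u i \<in> laurent_ring r u"
| inv_gen: "i \<in> {1..r} \<Longrightarrow> inverse (u i) \<in> laurent_ring r u"
| diff: "a \<in> laurent_ring r u \<Longrightarrow> b \<in> laurent_ring r u \<Longrightarrow> a - b \<in> laurent_ring r u"
| mult: "a \<in> laurent_ring r u \<Longrightarrow> b \<in> laurent_ring r u \<Longrightarrow> a * b \<in> laurent_ring r u"

text \<open>
  \<open>\<psi>\<close> restricts to the ring homomorphism \<open>\<int>[u\<^sup>\<plusminus>] \<rightarrow> \<int>\<close> sending every \<open>u i\<close> to 1.  It is
  determined on the Laurent ring by the lemma below; its values elsewhere are irrelevant.
\<close>

definition unit_specialisation :: "nat \<Rightarrow> (nat \<Rightarrow> 'a::field) \<Rightarrow> ('a \<Rightarrow> int) \<Rightarrow> bool" where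
  "unit_specialisation r u \<psi> \<longleftrightarrow>
     \<psi> 1 = 1 \<and>
     (\<forall>a\<in>laurent_ring r u. \<forall>b\<in>laurent_ring r u. \<psi> (a + b) = \<psi> a + \<psi> b \<and> \<psi> (a * b) = \<psi> a * \<psi> b) \<and>
     (\<forall>i\<in>{1..r}. \<psi> (u i) = 1)"

lemma unit_specialisation_unique:
  assumes "unit_specialisation r u \<psi>" "unit_specialisation r u \<psi>'" "a \<in> laurent_ring r u"
  shows "\<psi> a = \<psi>' a"
proof -
  have inv1: "\<chi> (inverse (u i)) = 1" if \<chi>: "unit_specialisation r u \<chi>" and i: "i \<in> {1..r}" for \<chi> i
  proof (cases "u i = 0")
    case True
    then have "inverse (u i) = u i" by simp
    with \<chi> i show ?thesis by (simp add: unit_specialisation_def)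
  next
    case False
    have "\<chi> (u i * inverse (u i)) = \<chi> (u i) * \<chi> (inverse (u i))"
      using \<chi> laurent_ring.gen[OF i] laurent_ring.inv_gen[OF i]
      unfolding unit_specialisation_def by blast
    with False \<chi> i show ?thesis by (auto simp: unit_specialisation_def)
  qed
  have minus: "\<chi> (a - b) = \<chi> a - \<chi> b"
    if "unit_specialisation r u \<chi>" "a \<in> laurent_ring r u" "b \<in> laurent_ring r u" for \<chi> a b
  proof -
    have "\<chi> ((a - b) + b) = \<chi> (a - b) + \<chi> b"
      using that laurent_ring.diff[OF that(2,3)] unfolding unit_specialisation_def by blast
    then show ?thesis by simp
  qed
  show ?thesis
    using assms(3)
  proof induction
    case one
    then show ?case using assms by (simp add: unit_specialisation_def)
  next
    case (gen i)
    then show ?case using assms by (simp add: unit_specialisation_def)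
  next
    case (inv_gen i)
    then show ?case using assms by (simp add: inv1)
  next
    case (diff a b)
    then show ?case using assms by (simp add: minus)
  next
    case (mult a b)
    then show ?case using assms(1,2) by (simp add: unit_specialisation_def)
  qed
qed

text \<open>
  \<open>z\<close> is an A-pattern (for friezes) or a Y-pattern (for Y-friezes).  The membership in the
  Laurent ring says that \<open>\<psi>\<close> is applied within its domain.
\<close>

definition unitary :: "nat \<Rightarrow> (nat list \<Rightarrow> nat \<Rightarrow> 'a::field) \<Rightarrow> (nat \<Rightarrow> int \<Rightarrow> int) \<Rightarrow> bool" where
  "unitary r z f \<longleftrightarrow>
     (\<exists>t\<in>tree_vertices r. \<exists>\<psi>. unit_specialisation r (z t) \<psi> \<and>
        (\<forall>i\<in>{1..r}. \<forall>m. z (belt r i m) i \<in> laurent_ring r (z t) \<and> f i m = \<psi> (z (belt r i m) i)))"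

end

theory Submission
  imports Defs
begin

text \<open>
  If all variables of \<open>x t\<close> are specialised to 1, then so are the monomials
  \<open>\<Prod>\<^sub>i x\<^sub>i ^ b\<^sub>i\<^sub>j\<close> in \<open>x t\<close>.  These monomials mutate like Y-variables, and at the belt they are the values
  of \<open>p_map\<close>; hence the Y-variables of the belt, evaluated at \<open>y t = 1\<close>, take these values too.

  It remains to see that \<open>y (belt r i m) i\<close> is Laurent in every Y-cluster.  Column \<open>i\<close> of the exchange
  matrix at \<open>belt r i m\<close> is nonnegative, so this variable is Laurent there and in all adjacent
  clusters, and this property propagates along the tree.  For a Laurent polynomial \<open>e\<close> in \<open>u\<close> to be
  Laurent after mutation at \<open>l\<close> means that its component of weight \<open>d < 0\<close>, for the grading by row \<open>l\<close>
  of the exchange matrix, is divisible by \<open>(1 + u\<^sub>l) ^ (-d)\<close>.  This is a condition on the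
  order of \<open>e\<close> for a monomial valuation centred at \<open>1 + u\<^sub>l = 0\<close>, and that valuation is unchanged
  by a mutation in another direction.
\<close>

section \<open>Laurent rings\<close>

definition monomial :: "nat \<Rightarrow> (nat \<Rightarrow> 'a::field) \<Rightarrow> (nat \<Rightarrow> int) \<Rightarrow> 'a" where
  "monomial r u n = (\<Prod>i\<in>{1..r}. u i powi n i)"

definition weight :: "nat \<Rightarrow> (nat \<Rightarrow> int) \<Rightarrow> (nat \<Rightarrow> int) \<Rightarrow> int" where
  "weight r \<omega> n = (\<Sum>i\<in>{1..r}. \<omega> i * n i)"

lemma monomial_cong: "(\<And>i. i \<in> {1..r} \<Longrightarrow> n i = m i) \<Longrightarrow> monomial r u n = monomial r u m"
  unfolding monomial_def by (intro prod.cong) simp_all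

lemma weight_cong: "(\<And>i. i \<in> {1..r} \<Longrightarrow> n i = m i) \<Longrightarrow> weight r \<omega> n = weight r \<omega> m"
  unfolding weight_def by (intro sum.cong) simp_all

lemma monomial_zero [simp]: "monomial r u (\<lambda>_. 0) = 1"
  by (simp add: monomial_def)

lemma monomial_add:
  assumes "\<And>i. i \<in> {1..r} \<Longrightarrow> u i \<noteq> 0"
  shows "monomial r u (\<lambda>i. n i + m i) = monomial r u n * monomial r u m"
  using assms by (simp add: monomial_def power_int_add prod.distrib)

lemma monomial_unit:
  assumes "k \<in> {1..r}"
  shows "monomial r u (\<lambda>i. if i = k then c else 0) = u k powi c"
proof -
  have "monomial r u (\<lambda>i. if i = k then c else 0) = (\<Prod>i\<in>{1..r}. if i = k then u i powi c else 1)"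
    unfolding monomial_def by (intro prod.cong) auto
  then show ?thesis using assms by simp
qed

lemma weight_add: "weight r \<omega> (\<lambda>i. n i + m i) = weight r \<omega> n + weight r \<omega> m"
  by (simp add: weight_def sum.distrib distrib_left)

lemma weight_unit:
  assumes "k \<in> {1..r}"
  shows "weight r \<omega> (\<lambda>i. if i = k then c else 0) = \<omega> k * c"
proof -
  have "weight r \<omega> (\<lambda>i. if i = k then c else 0) = (\<Sum>i\<in>{1..r}. if i = k then \<omega> i * c else 0)"
    unfolding weight_def by (intro sum.cong) auto
  then show ?thesis using assms by simp
qed

lemma laurent_zero [simp]: "0 \<in> laurent_ring r u"
  using laurent_ring.diff[OF laurent_ring.one laurent_ring.one] by simp

lemma laurent_uminus: "a \<in> laurent_ring r u \<Longrightarrow> - a \<in> laurent_ring r u"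
  using laurent_ring.diff[OF laurent_zero] by fastforce

lemma laurent_add: "a \<in> laurent_ring r u \<Longrightarrow> b \<in> laurent_ring r u \<Longrightarrow> a + b \<in> laurent_ring r u"
  using laurent_ring.diff[OF _ laurent_uminus] by fastforce

lemma laurent_power: "a \<in> laurent_ring r u \<Longrightarrow> a ^ n \<in> laurent_ring r u"
  by (induction n) (auto intro: laurent_ring.intros)

lemma laurent_powi:
  "a \<in> laurent_ring r u \<Longrightarrow> inverse a \<in> laurent_ring r u \<Longrightarrow> a powi n \<in> laurent_ring r u"
  by (simp add: power_int_def laurent_power)

lemma laurent_prod: "(\<And>i. i \<in> I \<Longrightarrow> g i \<in> laurent_ring r u) \<Longrightarrow> prod g I \<in> laurent_ring r u"
  by (induction I rule: infinite_finite_induct) (auto intro: laurent_ring.intros)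

lemma laurent_sum: "(\<And>i. i \<in> I \<Longrightarrow> g i \<in> laurent_ring r u) \<Longrightarrow> sum g I \<in> laurent_ring r u"
  by (induction I rule: infinite_finite_induct) (auto intro: laurent_add)

lemma laurent_gen_powi: "i \<in> {1..r} \<Longrightarrow> u i powi n \<in> laurent_ring r u"
  by (intro laurent_powi laurent_ring.gen laurent_ring.inv_gen)

lemma laurent_monomial: "monomial r u n \<in> laurent_ring r u"
  unfolding monomial_def by (intro laurent_prod laurent_gen_powi)

text \<open>Integer combinations of Laurent monomials, built with differences alone so that an
  induction over them has only two cases.\<close>

inductive_set monomial_span :: "nat \<Rightarrow> (nat \<Rightarrow> 'a::field) \<Rightarrow> 'a set"
  for r :: nat and u :: "nat \<Rightarrow> 'a" where
  mono: "monomial r u n \<in> monomial_span r u"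
| diff: "a \<in> monomial_span r u \<Longrightarrow> b \<in> monomial_span r u \<Longrightarrow> a - b \<in> monomial_span r u"

lemma monomial_span_mult:
  assumes nz: "\<And>i. i \<in> {1..r} \<Longrightarrow> u i \<noteq> 0"
    and "a \<in> monomial_span r u" "b \<in> monomial_span r u"
  shows "a * b \<in> monomial_span r u"
  using assms(2)
proof induction
  case (mono n)
  show ?case using assms(3)
  proof induction
    case (mono m)
    have "monomial r u (\<lambda>i. n i + m i) = monomial r u n * monomial r u m"
      by (rule monomial_add[OF nz])
    then show ?case using monomial_span.mono[of r u "\<lambda>i. n i + m i"] by simp
  next
    case (diff a b)
    then show ?case by (simp add: right_diff_distrib monomial_span.diff)
  qed
next
  case (diff a b)
  then show ?case by (simp add: left_diff_distrib monomial_span.diff)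
qed

text \<open>Monomials multiply to monomials as long as no \<open>u i\<close> vanishes, so their
  additive span is closed under products and exhausts the Laurent ring. Additive statements need
  checking on monomials only.\<close>

lemma laurent_additive_induct [consumes 2, case_names mono diff]:
  assumes a: "a \<in> laurent_ring r u" and nz: "\<forall>i\<in>{1..r}. u i \<noteq> 0"
    and mono: "\<And>n. P (monomial r u n)"
    and diff: "\<And>a b. a \<in> laurent_ring r u \<Longrightarrow> b \<in> laurent_ring r u \<Longrightarrow> P a \<Longrightarrow> P b \<Longrightarrow> P (a - b)"
  shows "P a"
proof -
  have gen_powi: "u i powi c \<in> monomial_span r u" if "i \<in> {1..r}" for i c
    using monomial_span.mono monomial_unit[OF that] by metis
  have "a \<in> monomial_span r u"
    using a
  proof induction
    case one
    show ?case using monomial_span.mono[of r u "\<lambda>_. 0"] by simp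
  next
    case (gen i)
    show ?case using gen_powi[OF gen, of 1] by simp
  next
    case (inv_gen i)
    show ?case using gen_powi[OF inv_gen, of "-1"] by (simp add: power_int_minus)
  next
    case (diff a b)
    then show ?case by (intro monomial_span.diff)
  next
    case (mult a b)
    then show ?case using nz by (intro monomial_span_mult) auto
  qed
  \<comment> \<open>Membership is carried along because \<open>diff\<close> demands it of both
    terms.\<close>
  then have "a \<in> laurent_ring r u \<and> P a"
    by induction (auto intro: mono diff laurent_monomial laurent_ring.diff)
  then show ?thesis ..
qed

text \<open>Multiplication by a monomial with large constant exponent \<open>N\<close> turns a
  relation among Laurent monomials into a polynomial relation. Exponents vanish outside
  \<open>{1..r}\<close> so that distinct functions are distinct exponent vectors.\<close>

lemma laurent_monomials_independent:
  fixes u :: "nat \<Rightarrow> 'a::field_char_0" and c :: "(nat \<Rightarrow> int) \<Rightarrow> rat"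
  assumes indep: "algebraically_independent r u" and nz: "\<And>i. i \<in> {1..r} \<Longrightarrow> u i \<noteq> 0"
    and S: "finite S" "\<And>n i. n \<in> S \<Longrightarrow> i \<notin> {1..r} \<Longrightarrow> n i = 0"
    and sum0: "(\<Sum>n\<in>S. of_rat (c n) * monomial r u n) = 0"
    and n: "n \<in> S"
  shows "c n = 0"
proof -
  \<comment> \<open>\<open>N\<close> bounds all \<open>- n i\<close>; inserting 0 keeps the set
    nonempty when \<open>r = 0\<close>.\<close>
  define N where "N = Max (insert 0 ((\<lambda>(n, i). - n i) ` (S \<times> {1..r})))"
  have N: "n i + N \<ge> 0" if "n \<in> S" "i \<in> {1..r}" for n i
  proof -
    have "- n i \<le> N" unfolding N_def using S that
      by (intro Max_ge) (auto intro!: image_eqI[of _ _ "(n, i)"])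
    then show ?thesis by simp
  qed
  define sh where "sh n = Abs_poly_mapping (\<lambda>i. if i \<in> {1..r} then nat (n i + N) else 0)" for n
  have lookup_sh: "Poly_Mapping.lookup (sh n) i = (if i \<in> {1..r} then nat (n i + N) else 0)" for n i
  proof -
    have "finite {i. (if i \<in> {1..r} then nat (n i + N) else 0) \<noteq> 0}"
      by (rule finite_subset[of _ "{1..r}"]) auto
    then show ?thesis by (simp add: sh_def)
  qed
  have inj: "inj_on sh S"
  proof (rule inj_onI, rule ext)
    fix n m i assume nm: "n \<in> S" "m \<in> S" "sh n = sh m"
    show "n i = m i"
    proof (cases "i \<in> {1..r}")
      case True
      then have "nat (n i + N) = nat (m i + N)" using lookup_sh[of n i] lookup_sh[of m i] nm by simp
      then show ?thesis using N[OF nm(1) True] N[OF nm(2) True] by simp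
    qed (use S(2)[OF nm(1)] S(2)[OF nm(2)] in simp)
  qed
  \<comment> \<open>The relation after the shift, its coefficients transported along the injection
    \<open>sh\<close>.\<close>
  define P where "P = Abs_poly_mapping (\<lambda>\<mu>. if \<mu> \<in> sh ` S then c (the_inv_into S sh \<mu>) else 0)"
  have lookup_P: "Poly_Mapping.lookup P \<mu> = (if \<mu> \<in> sh ` S then c (the_inv_into S sh \<mu>) else 0)" for \<mu>
  proof -
    have "finite {\<mu>. (if \<mu> \<in> sh ` S then c (the_inv_into S sh \<mu>) else 0) \<noteq> 0}"
      by (rule finite_subset[of _ "sh ` S"]) (use S in auto)
    then show ?thesis by (simp add: P_def)
  qed
  have P_sh: "Poly_Mapping.lookup P (sh n) = c n" if "n \<in> S" for n
    using that by (simp add: lookup_P the_inv_into_f_f[OF inj])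
  have keys: "Poly_Mapping.keys P \<subseteq> sh ` S"
    by (auto simp: in_keys_iff lookup_P split: if_splits)
  let ?t = "\<lambda>\<mu>. of_rat (Poly_Mapping.lookup P \<mu>) * (\<Prod>i\<in>{1..r}. u i ^ Poly_Mapping.lookup \<mu> i)"
  have "sum ?t (Poly_Mapping.keys P) = sum ?t (sh ` S)"
    using keys S by (intro sum.mono_neutral_left) (auto simp: in_keys_iff)
  also have "\<dots> = (\<Sum>n\<in>S. ?t (sh n))" by (simp add: sum.reindex[OF inj])
  also have "\<dots> = (\<Sum>n\<in>S. monomial r u (\<lambda>_. N) * (of_rat (c n) * monomial r u n))"
  proof (rule sum.cong[OF refl])
    fix n assume n: "n \<in> S"
    have "(\<Prod>i\<in>{1..r}. u i ^ Poly_Mapping.lookup (sh n) i) = monomial r u (\<lambda>i. n i + N)"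
      unfolding monomial_def using N[OF n]
      by (intro prod.cong) (simp_all add: lookup_sh power_int_nonneg_exp)
    also have "\<dots> = monomial r u n * monomial r u (\<lambda>_. N)" by (rule monomial_add[OF nz])
    finally show "?t (sh n) = monomial r u (\<lambda>_. N) * (of_rat (c n) * monomial r u n)"
      using n by (simp add: P_sh)
  qed
  also have "\<dots> = 0" by (simp only: sum_distrib_left[symmetric] sum0 mult_zero_right)
  finally have "sum ?t (Poly_Mapping.keys P) = 0" .
  moreover have "Poly_Mapping.keys \<mu> \<subseteq> {1..r}" if "\<mu> \<in> Poly_Mapping.keys P" for \<mu>
    using that keys by (auto simp: in_keys_iff lookup_sh split: if_splits)
  ultimately have "P = 0" using indep unfolding algebraically_independent_def by blast
  then show ?thesis using P_sh[OF n] by simp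
qed

text \<open>Independence is applied to the polynomial that is the single variable with index
  \<open>k\<close>.\<close>

lemma algebraically_independent_nonzero:
  fixes u :: "nat \<Rightarrow> 'a::field_char_0"
  assumes "algebraically_independent r u" "k \<in> {1..r}"
  shows "u k \<noteq> 0"
proof
  assume u0: "u k = 0"
  define P :: "(nat \<Rightarrow>\<^sub>0 nat) \<Rightarrow>\<^sub>0 rat" where "P = Poly_Mapping.single (Poly_Mapping.single k 1) 1"
  have prod: "(\<Prod>i\<in>{1..r}. u i ^ (if k = i then Suc 0 else 0)) = u k"
  proof -
    have "(\<Prod>i\<in>{1..r}. u i ^ (if k = i then Suc 0 else 0)) = (\<Prod>i\<in>{1..r}. if k = i then u i else 1)"
      by (intro prod.cong) auto
    then show ?thesis using assms(2) by simp
  qed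
  have "P = 0"
    using assms(1)[unfolded algebraically_independent_def, rule_format, of P] assms(2) u0
    by (simp add: P_def lookup_single when_def prod split: if_splits)
  moreover have "Poly_Mapping.lookup P (Poly_Mapping.single k 1) = 1" by (simp add: P_def)
  ultimately show False by simp
qed

section \<open>The ambient field as a vector space over the rationals\<close>

definition rat_scale :: "rat \<Rightarrow> 'a \<Rightarrow> 'a::field_char_0" where
  "rat_scale q a = of_rat q * a"

interpretation rat_space: vector_space "rat_scale :: rat \<Rightarrow> 'a \<Rightarrow> 'a::field_char_0"
  by unfold_locales (simp_all add: rat_scale_def algebra_simps of_rat_add of_rat_mult)

interpretation rat_space_pair: vector_space_pair
  "rat_scale :: rat \<Rightarrow> 'a \<Rightarrow> 'a::field_char_0" "rat_scale :: rat \<Rightarrow> 'b \<Rightarrow> 'b::field_char_0"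
  by unfold_locales

text \<open>Distinct Laurent monomials are linearly independent over the rationals, so values
  prescribed on them extend to a linear map on the whole ambient field. This supplies both the unit
  specialisation and the projections to weight components.\<close>

lemma additive_extension:
  fixes u :: "nat \<Rightarrow> 'a::field_char_0" and \<phi> :: "(nat \<Rightarrow> int) \<Rightarrow> 'b::field_char_0"
  assumes indep: "algebraically_independent r u"
    and \<phi>: "\<And>n m. (\<And>i. i \<in> {1..r} \<Longrightarrow> n i = m i) \<Longrightarrow> \<phi> n = \<phi> m"
  shows "\<exists>g :: 'a \<Rightarrow> 'b. (\<forall>a b. g (a - b) = g a - g b) \<and> (\<forall>n. g (monomial r u n) = \<phi> n)"
proof -
  have nz: "u i \<noteq> 0" if "i \<in> {1..r}" for i
    by (rule algebraically_independent_nonzero[OF indep that])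
  \<comment> \<open>Exponent functions are normalised to 0 outside \<open>{1..r}\<close>; this makes
    the monomial map injective.\<close>
  define E where "E = {n :: nat \<Rightarrow> int. \<forall>i. i \<notin> {1..r} \<longrightarrow> n i = 0}"
  have inj: "inj_on (monomial r u) E"
  proof (rule inj_onI, rule ccontr)
    fix n m assume nm: "n \<in> E" "m \<in> E" "monomial r u n = monomial r u m" "n \<noteq> m"
    define c :: "(nat \<Rightarrow> int) \<Rightarrow> rat" where "c k = (if k = n then 1 else - 1)" for k
    have "c n = 0"
    proof (rule laurent_monomials_independent[OF indep nz, of "{n, m}"])
      show "(\<Sum>k\<in>{n, m}. of_rat (c k) * monomial r u k) = 0"
        using nm by (auto simp: c_def of_rat_minus)
    qed (use nm in \<open>auto simp: E_def\<close>)
    then show False by (simp add: c_def)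
  qed
  have "rat_space.independent (monomial r u ` E)"
    unfolding rat_space.independent_explicit_module
  proof (intro allI impI)
    fix t and c :: "'a \<Rightarrow> rat" and v
    assume t: "finite t" "t \<subseteq> monomial r u ` E" "(\<Sum>v\<in>t. rat_scale (c v) v) = 0" "v \<in> t"
    obtain S where S: "S \<subseteq> E" "finite S" "t = monomial r u ` S"
      using t(1,2) by (meson finite_subset_image)
    have injS: "inj_on (monomial r u) S" using inj S(1) by (rule inj_on_subset)
    obtain n where n: "n \<in> S" "v = monomial r u n" using t(4) S(3) by auto
    have "c (monomial r u n) = 0"
    proof (rule laurent_monomials_independent[OF indep nz S(2) _ _ n(1)])
      show "(\<Sum>n\<in>S. of_rat (c (monomial r u n)) * monomial r u n) = 0"
        using t(3) by (simp add: S(3) sum.reindex[OF injS] rat_scale_def)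
    qed (use S(1) in \<open>auto simp: E_def\<close>)
    then show "c v = 0" by (simp add: n)
  qed
  then obtain g :: "'a \<Rightarrow> 'b" where g: "Vector_Spaces.linear rat_scale rat_scale g"
    "\<forall>v\<in>monomial r u ` E. g v = \<phi> (the_inv_into E (monomial r u) v)"
    using rat_space_pair.linear_independent_extend[of "monomial r u ` E" "\<lambda>v. \<phi> (the_inv_into E (monomial r u) v)"]
    by blast
  interpret g: Vector_Spaces.linear rat_scale rat_scale g by (rule g(1))
  have "g (monomial r u n) = \<phi> n" for n
  proof -
    define n' where "n' i = (if i \<in> {1..r} then n i else 0)" for i
    have "n' \<in> E" by (simp add: E_def n'_def)
    then have "g (monomial r u n') = \<phi> n'" using g(2) by (simp add: the_inv_into_f_f[OF inj])
    moreover have "monomial r u n' = monomial r u n" "\<phi> n' = \<phi> n"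
      by (auto intro!: monomial_cong \<phi> simp: n'_def)
    ultimately show ?thesis by simp
  qed
  then show ?thesis using g.diff by blast
qed

text \<open>The linear map sending every monomial to 1 is integer valued and multiplicative on the
  Laurent ring, since both claims reduce to monomials.\<close>

lemma unit_specialisation_exists:
  fixes u :: "nat \<Rightarrow> 'a::field_char_0"
  assumes indep: "algebraically_independent r u"
  shows "\<exists>\<psi>. unit_specialisation r u \<psi>"
proof -
  have nz: "\<forall>i\<in>{1..r}. u i \<noteq> 0"
    using algebraically_independent_nonzero[OF indep] by blast
  obtain g :: "'a \<Rightarrow> rat" where g: "\<And>a b. g (a - b) = g a - g b" "\<And>n. g (monomial r u n) = 1"
    using additive_extension[OF indep, of "\<lambda>_. 1"] by blast
  have g0: "g 0 = 0" using g(1)[of 0 0] by simp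
  have g_add: "g (a + b) = g a + g b" for a b using g(1)[of a "- b"] g(1)[of 0 b] g0 by simp
  have int: "g a \<in> \<int>" if "a \<in> laurent_ring r u" for a
    using that nz by (induction rule: laurent_additive_induct) (simp_all add: g)
  have mult: "g (a * b) = g a * g b" if "a \<in> laurent_ring r u" "b \<in> laurent_ring r u" for a b
    using that(1) nz
  proof (induction rule: laurent_additive_induct)
    case (mono n)
    show ?case using that(2) nz
    proof (induction rule: laurent_additive_induct)
      case (mono m)
      have "g (monomial r u n * monomial r u m) = 1"
        using g(2)[of "\<lambda>i. n i + m i"] monomial_add[of r u n m] nz by simp
      then show ?case by (simp add: g)
    qed (simp add: right_diff_distrib g)
  qed (simp add: left_diff_distrib g)
  have gen: "g (u i) = 1" if "i \<in> {1..r}" for i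
    using g(2)[of "\<lambda>j. if j = i then 1 else 0"] by (simp only: monomial_unit[OF that] power_int_1_right)
  have one: "g 1 = 1" using g(2)[of "\<lambda>_. 0"] by simp
  \<comment> \<open>On the Laurent ring \<open>g\<close> is integral, so the floor only changes the
    type.\<close>
  have "unit_specialisation r u (\<lambda>a. \<lfloor>g a\<rfloor>)"
    unfolding unit_specialisation_def
  proof (intro conjI ballI)
    fix a b assume ab: "a \<in> laurent_ring r u" "b \<in> laurent_ring r u"
    obtain k l where kl: "g a = of_int k" "g b = of_int l" using int ab by (metis Ints_cases)
    have "g a * g b = of_int (k * l)" by (simp add: kl)
    then have "\<lfloor>g a * g b\<rfloor> = k * l" by (metis floor_of_int)
    then show "\<lfloor>g (a * b)\<rfloor> = \<lfloor>g a\<rfloor> * \<lfloor>g b\<rfloor>" using ab by (simp add: mult kl)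
    show "\<lfloor>g (a + b)\<rfloor> = \<lfloor>g a\<rfloor> + \<lfloor>g b\<rfloor>" by (simp add: g_add kl)
  qed (simp_all add: gen one)
  then show ?thesis by blast
qed

text \<open>The grading in which \<open>u i\<close> has degree \<open>\<omega> i\<close>, given
  through its projections \<open>pr d\<close>. They are maps of the whole ambient field, but
  meaningful on the Laurent ring, where the axioms determine them.\<close>

locale weight_projection =
  fixes r :: nat and u :: "nat \<Rightarrow> 'a::field_char_0" and \<omega> :: "nat \<Rightarrow> int" and pr :: "int \<Rightarrow> 'a \<Rightarrow> 'a"
  assumes nonzero: "\<forall>i\<in>{1..r}. u i \<noteq> 0"
    and pr_diff: "pr d (a - b) = pr d a - pr d b"
    and pr_mono: "pr d (monomial r u n) = (if weight r \<omega> n = d then monomial r u n else 0)"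
begin

lemma zero [simp]: "pr d 0 = 0"
  using pr_diff[of d 0 0] by simp

lemma add: "pr d (a + b) = pr d a + pr d b"
  using pr_diff[of d a "- b"] pr_diff[of d 0 b] by simp

lemma in_laurent:
  assumes "a \<in> laurent_ring r u"
  shows "pr d a \<in> laurent_ring r u"
  using assms nonzero
  by (induction rule: laurent_additive_induct) (simp_all add: pr_mono pr_diff laurent_monomial laurent_ring.diff)

lemma idem:
  assumes "a \<in> laurent_ring r u"
  shows "pr d (pr d a) = pr d a"
  using assms nonzero by (induction rule: laurent_additive_induct) (simp_all add: pr_mono pr_diff)

lemma sum_eq:
  assumes "a \<in> laurent_ring r u"
  shows "\<exists>D. finite D \<and> (\<forall>d. d \<notin> D \<longrightarrow> pr d a = 0) \<and> a = (\<Sum>d\<in>D. pr d a)"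
  using assms nonzero
proof (induction rule: laurent_additive_induct)
  case (mono n)
  show ?case by (intro exI[of _ "{weight r \<omega> n}"]) (simp add: pr_mono)
next
  case (diff a b)
  then obtain D D' where D: "finite D" "\<forall>d. d \<notin> D \<longrightarrow> pr d a = 0" "a = (\<Sum>d\<in>D. pr d a)"
    and D': "finite D'" "\<forall>d. d \<notin> D' \<longrightarrow> pr d b = 0" "b = (\<Sum>d\<in>D'. pr d b)" by blast
  have "(\<Sum>d\<in>D. pr d a) = (\<Sum>d\<in>D \<union> D'. pr d a)" "(\<Sum>d\<in>D'. pr d b) = (\<Sum>d\<in>D \<union> D'. pr d b)"
    using D(1,2) D'(1,2) by (intro sum.mono_neutral_left; simp)+
  then have "a - b = (\<Sum>d\<in>D \<union> D'. pr d (a - b))"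
    using D(3) D'(3) by (simp add: pr_diff sum_subtractf)
  moreover have "\<forall>d. d \<notin> D \<union> D' \<longrightarrow> pr d (a - b) = 0" using D(2) D'(2) by (simp add: pr_diff)
  ultimately show ?case using D(1) D'(1) by blast
qed

lemma gen_mult:
  assumes "a \<in> laurent_ring r u" "k \<in> {1..r}"
  shows "pr d (u k * a) = u k * pr (d - \<omega> k) a"
  using assms(1) nonzero
proof (induction rule: laurent_additive_induct)
  case (mono n)
  let ?n = "\<lambda>i. (if i = k then 1 else 0) + n i"
  have "u k * monomial r u n = monomial r u ?n"
    using monomial_add[of r u "\<lambda>i. if i = k then 1 else 0" n] monomial_unit[OF assms(2), of u 1] nonzero
    by simp
  moreover have "weight r \<omega> ?n = \<omega> k + weight r \<omega> n"
    by (simp only: weight_add weight_unit[OF assms(2)] mult_1_right)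
  ultimately show ?case by (simp add: pr_mono eq_diff_eq add.commute)
qed (simp add: right_diff_distrib pr_diff)

text \<open>With \<open>\<omega> k = 0\<close> the factor \<open>1 + u k\<close> is homogeneous of
  degree 0, so it passes through every projection.\<close>

lemma succ_gen_power_mult:
  assumes "a \<in> laurent_ring r u" "k \<in> {1..r}" "\<omega> k = 0"
  shows "pr d ((1 + u k) ^ N * a) = (1 + u k) ^ N * pr d a"
proof (induction N)
  case (Suc N)
  have "(1 + u k) ^ N * a \<in> laurent_ring r u"
    using assms by (intro laurent_ring.mult laurent_power laurent_add) (auto intro: laurent_ring.intros)
  from gen_mult[OF this assms(2), of d] show ?case
    using Suc assms(3) by (simp add: distrib_right mult.assoc add)
qed simp

end

lemma weight_projection_exists:
  fixes u :: "nat \<Rightarrow> 'a::field_char_0"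
  assumes indep: "algebraically_independent r u"
  obtains pr where "weight_projection r u \<omega> pr"
proof -
  have nz: "u i \<noteq> 0" if "i \<in> {1..r}" for i
    by (rule algebraically_independent_nonzero[OF indep that])
  have "\<exists>g. (\<forall>a b. g (a - b) = g a - g b) \<and>
      (\<forall>n. g (monomial r u n) = (if weight r \<omega> n = d then monomial r u n else 0))" for d
    by (rule additive_extension[OF indep]) (metis weight_cong monomial_cong)
  then obtain pr where "\<forall>d. (\<forall>a b. pr d (a - b) = pr d a - pr d b) \<and>
      (\<forall>n. pr d (monomial r u n) = (if weight r \<omega> n = d then monomial r u n else 0))"
    by metis
  then have "weight_projection r u \<omega> pr" by unfold_locales (auto simp: nz)
  then show ?thesis by (rule that)
qed

section \<open>Y-mutation and weight components\<close>

lemma power_int_sum: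
  fixes a :: "'a::field"
  assumes "a \<noteq> 0"
  shows "a powi (\<Sum>i\<in>I. g i) = (\<Prod>i\<in>I. a powi g i)"
  using assms by (induction I rule: infinite_finite_induct) (simp_all add: power_int_add)

text \<open>For the grading by total degree, the component of \<open>1 + u k\<close> in degree 0 is
  1.\<close>

lemma one_plus_gen_nonzero:
  fixes u :: "nat \<Rightarrow> 'a::field_char_0"
  assumes indep: "algebraically_independent r u" and k: "k \<in> {1..r}"
  shows "1 + u k \<noteq> 0"
proof
  assume "1 + u k = 0"
  obtain pr where "weight_projection r u (\<lambda>_. 1) pr"
    by (rule weight_projection_exists[OF indep])
  then interpret weight_projection r u "\<lambda>_. 1" pr .
  have "pr 0 1 = 1" using pr_mono[of 0 "\<lambda>_. 0"] by (simp add: weight_def)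
  moreover have "pr 0 (u k) = 0"
    using pr_mono[of 0 "\<lambda>i. if i = k then 1 else 0"] by (simp only: monomial_unit[OF k] weight_unit[OF k]) simp
  ultimately have "pr 0 (1 + u k) = 1" by (simp add: add)
  then show False using \<open>1 + u k = 0\<close> by simp
qed

definition Y_mutation :: "nat \<Rightarrow> (nat \<Rightarrow> nat \<Rightarrow> int) \<Rightarrow> nat \<Rightarrow> (nat \<Rightarrow> 'a::field) \<Rightarrow> (nat \<Rightarrow> 'a) \<Rightarrow> bool" where
  "Y_mutation r B k u u' \<longleftrightarrow> u' k = inverse (u k) \<and>
     (\<forall>j\<in>{1..r} - {k}. u' j = u j * u k ^ nat (B k j) * (1 + u k) powi (- B k j))"

text \<open>Each \<open>u' j\<close> carries the factor \<open>(1 + u k) powi (- B k j)\<close>, so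
  the exponents of \<open>1 + u k\<close> add up to minus the weight for row \<open>k\<close>. The
  other changes affect only the exponent of \<open>u k\<close>, which has weight
  \<open>B k k = 0\<close>.\<close>

lemma monomial_Y_mutation:
  fixes u :: "nat \<Rightarrow> 'a::field_char_0"
  assumes mut: "Y_mutation r B k u u'" and indep: "algebraically_independent r u"
    and k: "k \<in> {1..r}" and Bkk: "B k k = 0"
  shows "\<exists>n'. weight r (B k) n' = weight r (B k) n \<and>
    monomial r u' n = monomial r u n' * (1 + u k) powi (- weight r (B k) n)"
proof -
  have nz: "u i \<noteq> 0" if "i \<in> {1..r}" for i
    using algebraically_independent_nonzero[OF indep that] .
  have p: "1 + u k \<noteq> 0" by (rule one_plus_gen_nonzero[OF indep k])
  \<comment> \<open>\<open>m\<close> accounts for the inversion of \<open>u k\<close>, and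
    \<open>K\<close> for the powers of \<open>u k\<close> contributed by the other
    variables.\<close>
  define m where "m i = (if i = k then - n i else n i)" for i
  define K where "K = (\<Sum>i\<in>{1..r}. max (B k i) 0 * n i)"
  have "monomial r u' n = (\<Prod>i\<in>{1..r}. u i powi m i * u k powi (max (B k i) 0 * n i) * (1 + u k) powi (- (B k i * n i)))"
    unfolding monomial_def
  proof (rule prod.cong[OF refl])
    fix i assume i: "i \<in> {1..r}"
    have "u k ^ nat (B k i) = u k powi (max (B k i) 0)"
      by (cases "B k i \<ge> 0") (simp_all add: power_int_nonneg_exp max_def)
    then show "u' i powi n i = u i powi m i * u k powi (max (B k i) 0 * n i) * (1 + u k) powi (- (B k i * n i))"
      using mut i Bkk by (cases "i = k")
        (simp_all add: Y_mutation_def m_def power_int_mult_distrib power_int_mult[symmetric]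
          power_int_minus power_int_inverse)
  qed
  also have "\<dots> = monomial r u m * u k powi K * (1 + u k) powi (- weight r (B k) n)"
    using nz[OF k] p by (simp add: prod.distrib monomial_def K_def weight_def power_int_sum sum_negf[symmetric])
  also have "monomial r u m * u k powi K = monomial r u (\<lambda>i. m i + (if i = k then K else 0))"
    by (simp only: monomial_add[OF nz] monomial_unit[OF k])
  finally have "monomial r u' n = monomial r u (\<lambda>i. m i + (if i = k then K else 0)) * (1 + u k) powi (- weight r (B k) n)" .
  moreover have "weight r (B k) (\<lambda>i. m i + (if i = k then K else 0)) = weight r (B k) n"
  proof -
    have "weight r (B k) m = weight r (B k) n"
      unfolding weight_def using Bkk by (intro sum.cong) (auto simp: m_def)
    then show ?thesis by (simp only: weight_add weight_unit[OF k] Bkk mult_zero_left add_0_right)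
  qed
  ultimately show ?thesis by blast
qed

text \<open>The component of weight \<open>d\<close> comes from the monomials of weight
  \<open>d\<close> in \<open>u'\<close>, and each of these contributes
  \<open>(1 + u k) powi (- d)\<close>. The content lies in \<open>d < 0\<close>, where this is
  divisibility by a positive power of \<open>1 + u k\<close>.\<close>

lemma weight_component_mutated:
  fixes u :: "nat \<Rightarrow> 'a::field_char_0"
  assumes mut: "Y_mutation r B k u u'" and indep: "algebraically_independent r u"
    and nz': "\<forall>i\<in>{1..r}. u' i \<noteq> 0"
    and k: "k \<in> {1..r}" and Bkk: "B k k = 0"
    and pr: "weight_projection r u (B k) pr"
    and e: "e \<in> laurent_ring r u" "e \<in> laurent_ring r u'"
  shows "\<exists>b\<in>laurent_ring r u. pr d e = (1 + u k) powi (- d) * b"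
proof -
  interpret weight_projection r u "B k" pr by (rule pr)
  let ?p = "1 + u k"
  have p: "?p \<noteq> 0" by (rule one_plus_gen_nonzero[OF indep k])
  have p_in: "?p \<in> laurent_ring r u" using k by (intro laurent_add laurent_ring.one laurent_ring.gen)
  \<comment> \<open>A monomial in \<open>u'\<close> need not be Laurent in \<open>u\<close>, where
    \<open>pr\<close> is understood, so a large power of \<open>1 + u k\<close> is applied first.
    Asking for all \<open>N \<ge> N0\<close> makes the claim stable under differences.\<close>
  have "\<exists>N0. \<forall>N\<ge>N0. ?p ^ N * e \<in> laurent_ring r u \<and>
      (\<exists>b\<in>laurent_ring r u. pr d (?p ^ N * e) = ?p powi (int N - d) * b)"
    using e(2) nz'
  proof (induction rule: laurent_additive_induct)
    case (mono n)
    obtain n' where n': "weight r (B k) n' = weight r (B k) n"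
        "monomial r u' n = monomial r u n' * ?p powi (- weight r (B k) n)"
      using monomial_Y_mutation[OF mut indep k Bkk] by blast
    define c where "c = weight r (B k) n"
    show ?case
    proof (intro exI[of _ "nat \<bar>c\<bar>"] allI impI)
      fix N assume "nat \<bar>c\<bar> \<le> N"
      then have c: "int N - c \<ge> 0" by simp
      have eq: "?p ^ N * monomial r u' n = ?p ^ nat (int N - c) * monomial r u n'"
        using p c by (simp add: n' c_def power_int_add power_int_nonneg_exp[symmetric] power_int_diff power_int_minus field_simps)
      have "pr d (?p ^ N * monomial r u' n) = ?p ^ nat (int N - c) * (if c = d then monomial r u n' else 0)"
        unfolding eq using succ_gen_power_mult[OF laurent_monomial k Bkk] n'(1)
        by (simp add: pr_mono c_def)
      also have "\<dots> = ?p powi (int N - d) * (if c = d then monomial r u n' else 0)"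
        using c by (simp add: power_int_nonneg_exp)
      finally show "?p ^ N * monomial r u' n \<in> laurent_ring r u \<and>
          (\<exists>b\<in>laurent_ring r u. pr d (?p ^ N * monomial r u' n) = ?p powi (int N - d) * b)"
        unfolding eq using p_in by (auto intro!: laurent_ring.mult laurent_power laurent_monomial
            intro: bexI[of _ "if c = d then monomial r u n' else 0"] simp: laurent_monomial)
    qed
  next
    case (diff a b)
    then obtain N1 N2 where
      N1: "\<And>N. N \<ge> N1 \<Longrightarrow> ?p ^ N * a \<in> laurent_ring r u \<and>
        (\<exists>c\<in>laurent_ring r u. pr d (?p ^ N * a) = ?p powi (int N - d) * c)" and
      N2: "\<And>N. N \<ge> N2 \<Longrightarrow> ?p ^ N * b \<in> laurent_ring r u \<and>
        (\<exists>c\<in>laurent_ring r u. pr d (?p ^ N * b) = ?p powi (int N - d) * c)"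
      by blast
    show ?case
    proof (intro exI[of _ "max N1 N2"] allI impI)
      fix N assume N: "max N1 N2 \<le> N"
      then obtain c c' where c: "c \<in> laurent_ring r u" "pr d (?p ^ N * a) = ?p powi (int N - d) * c"
        and c': "c' \<in> laurent_ring r u" "pr d (?p ^ N * b) = ?p powi (int N - d) * c'"
        using N1[of N] N2[of N] by auto
      have "pr d (?p ^ N * (a - b)) = ?p powi (int N - d) * (c - c')"
        by (simp only: right_diff_distrib pr_diff c c')
      moreover have "?p ^ N * (a - b) \<in> laurent_ring r u"
        using N N1[of N] N2[of N] by (simp add: right_diff_distrib laurent_ring.diff)
      ultimately show "?p ^ N * (a - b) \<in> laurent_ring r u \<and>
          (\<exists>c\<in>laurent_ring r u. pr d (?p ^ N * (a - b)) = ?p powi (int N - d) * c)"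
        using c(1) c'(1) laurent_ring.diff by blast
    qed
  qed
  then obtain N b where b: "b \<in> laurent_ring r u" "pr d (?p ^ N * e) = ?p powi (int N - d) * b"
    by blast
  \<comment> \<open>Since \<open>e\<close> itself is Laurent in \<open>u\<close>, the auxiliary
    power can be pulled out of \<open>pr d\<close> and cancelled.\<close>
  have "?p ^ N * pr d e = ?p powi (int N - d) * b"
    using b(2) by (simp only: succ_gen_power_mult[OF e(1) k Bkk])
  then have "pr d e = ?p powi (- d) * b"
    using p by (simp add: power_int_diff power_int_minus field_simps)
  with b(1) show ?thesis by blast
qed

section \<open>Localisation of the Laurent ring at one element\<close>

definition laurent_localisation :: "nat \<Rightarrow> (nat \<Rightarrow> 'a::field) \<Rightarrow> 'a \<Rightarrow> 'a set" where
  "laurent_localisation r u q = {a. \<exists>N. q ^ N * a \<in> laurent_ring r u}"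

context
  fixes r :: nat and u :: "nat \<Rightarrow> 'a::field" and q :: 'a
  assumes q: "q \<in> laurent_ring r u"
begin

lemma localisation_of_laurent: "a \<in> laurent_ring r u \<Longrightarrow> a \<in> laurent_localisation r u q"
  unfolding laurent_localisation_def by (auto intro: exI[of _ 0])

lemma localisation_inverse: "q \<noteq> 0 \<Longrightarrow> inverse q \<in> laurent_localisation r u q"
  unfolding laurent_localisation_def by (auto intro!: exI[of _ 1] laurent_ring.one)

lemma localisation_mult:
  assumes "a \<in> laurent_localisation r u q" "b \<in> laurent_localisation r u q"
  shows "a * b \<in> laurent_localisation r u q"
proof -
  obtain N M where "q ^ N * a \<in> laurent_ring r u" "q ^ M * b \<in> laurent_ring r u"
    using assms by (auto simp: laurent_localisation_def)
  then have "(q ^ N * a) * (q ^ M * b) \<in> laurent_ring r u" by (rule laurent_ring.mult)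
  then have "q ^ (N + M) * (a * b) \<in> laurent_ring r u" by (simp add: power_add mult_ac)
  then show ?thesis by (auto simp: laurent_localisation_def)
qed

lemma localisation_diff:
  assumes "a \<in> laurent_localisation r u q" "b \<in> laurent_localisation r u q"
  shows "a - b \<in> laurent_localisation r u q"
proof -
  obtain N M where NM: "q ^ N * a \<in> laurent_ring r u" "q ^ M * b \<in> laurent_ring r u"
    using assms by (auto simp: laurent_localisation_def)
  have "q ^ M * (q ^ N * a) - q ^ N * (q ^ M * b) \<in> laurent_ring r u"
    by (intro laurent_ring.diff laurent_ring.mult laurent_power q NM)
  then have "q ^ (N + M) * (a - b) \<in> laurent_ring r u" by (simp add: power_add algebra_simps)
  then show ?thesis by (auto simp: laurent_localisation_def)
qed

lemma localisation_add:
  assumes "a \<in> laurent_localisation r u q" "b \<in> laurent_localisation r u q"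
  shows "a + b \<in> laurent_localisation r u q"
  using localisation_diff[OF assms(1) localisation_diff[OF localisation_of_laurent[OF laurent_zero] assms(2)]]
  by simp

lemma localisation_power:
  "a \<in> laurent_localisation r u q \<Longrightarrow> a ^ n \<in> laurent_localisation r u q"
  by (induction n) (auto intro: localisation_mult localisation_of_laurent laurent_ring.one)

lemma localisation_powi:
  "a \<in> laurent_localisation r u q \<Longrightarrow> inverse a \<in> laurent_localisation r u q \<Longrightarrow>
    a powi n \<in> laurent_localisation r u q"
  by (simp add: power_int_def localisation_power)

lemma localisation_sum:
  "(\<And>i. i \<in> I \<Longrightarrow> g i \<in> laurent_localisation r u q) \<Longrightarrow> sum g I \<in> laurent_localisation r u q"
  by (induction I rule: infinite_finite_induct)
    (auto intro: localisation_add localisation_of_laurent)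

end

section \<open>Propagation of the Laurent property\<close>

definition sign_skew :: "nat \<Rightarrow> (nat \<Rightarrow> nat \<Rightarrow> int) \<Rightarrow> bool" where
  "sign_skew r B \<longleftrightarrow> (\<forall>i\<in>{1..r}. \<forall>j\<in>{1..r}. sgn (B i j) = - sgn (B j i))"

lemma sign_skewD:
  assumes "sign_skew r B" "i \<in> {1..r}" "j \<in> {1..r}"
  shows "B i i = 0" "B i j > 0 \<longleftrightarrow> B j i < 0" "B i j < 0 \<longleftrightarrow> B j i > 0" "B i j = 0 \<longleftrightarrow> B j i = 0"
proof -
  have "sgn (B i j) = - sgn (B j i)" "sgn (B i i) = - sgn (B i i)"
    using assms unfolding sign_skew_def by blast+
  then show "B i i = 0" "B i j > 0 \<longleftrightarrow> B j i < 0" "B i j < 0 \<longleftrightarrow> B j i > 0" "B i j = 0 \<longleftrightarrow> B j i = 0"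
    by (auto simp: sgn_if split: if_splits)
qed

text \<open>In the grading by the degree in \<open>u k\<close> the factor \<open>1 + u l\<close> has
  degree 0, so comparing components gives
  \<open>pr d a = (1 + u l) * pr d b - u k * pr (d - 1) a\<close>. Divisibility by
  \<open>1 + u l\<close> therefore climbs from the bottom of the support of
  \<open>a\<close>.\<close>

lemma succ_gens_coprime:
  fixes u :: "nat \<Rightarrow> 'a::field_char_0"
  assumes indep: "algebraically_independent r u"
    and kl: "k \<in> {1..r}" "l \<in> {1..r}" "k \<noteq> l"
    and a: "a \<in> laurent_ring r u" and b: "b \<in> laurent_ring r u"
    and ab: "(1 + u k) * a = (1 + u l) * b"
  shows "\<exists>b'\<in>laurent_ring r u. a = (1 + u l) * b'"
proof -
  define \<omega> :: "nat \<Rightarrow> int" where "\<omega> i = (if i = k then 1 else 0)" for i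
  obtain pr where "weight_projection r u \<omega> pr"
    by (rule weight_projection_exists[OF indep])
  then interpret weight_projection r u \<omega> pr .
  let ?M = "(\<lambda>b. (1 + u l) * b) ` laurent_ring r u"
  obtain D where D: "finite D" "\<forall>d. d \<notin> D \<longrightarrow> pr d a = 0" "a = (\<Sum>d\<in>D. pr d a)"
    using sum_eq[OF a] by blast
  have step: "pr d a = (1 + u l) * pr d b - u k * pr (d - 1) a" for d
  proof -
    have "pr d ((1 + u k) * a) = pr d a + u k * pr (d - 1) a"
      using gen_mult[OF a kl(1), of d] by (simp add: distrib_right add \<omega>_def)
    moreover have "pr d ((1 + u l) * b) = (1 + u l) * pr d b"
      using succ_gen_power_mult[OF b kl(2), of d 1] kl(3) by (simp add: \<omega>_def)
    ultimately show ?thesis using ab by (simp add: algebra_simps)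
  qed
  \<comment> \<open>\<open>m\<close> lies at or below every degree occurring in \<open>a\<close>, so
    the upward recursion starts from 0 in degree \<open>m - 1\<close>.\<close>
  define m where "m = Min (insert 0 D)"
  have m: "m \<le> d" if "d \<in> D" for d using D(1) that by (simp add: m_def)
  have zero_in: "0 \<in> ?M" by (rule image_eqI[of _ _ 0]) simp_all
  have low: "pr d a = 0" if "d < m" for d by (rule ccontr) (use m[of d] D(2) that in auto)
  have up: "pr (m - 1 + int n) a \<in> ?M" for n
  proof (induction n)
    case 0
    show ?case using low[of "m - 1"] zero_in by simp
  next
    case (Suc n)
    then obtain c where c: "c \<in> laurent_ring r u" "pr (m - 1 + int n) a = (1 + u l) * c" by blast
    have "pr (m - 1 + int (Suc n)) a = (1 + u l) * (pr (m - 1 + int (Suc n)) b - u k * c)"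
      using step[of "m - 1 + int (Suc n)"] c(2) by (simp add: algebra_simps)
    moreover have "pr (m - 1 + int (Suc n)) b - u k * c \<in> laurent_ring r u"
      by (intro laurent_ring.diff laurent_ring.mult in_laurent b laurent_ring.gen kl(1) c(1))
    ultimately show ?case by blast
  qed
  have "pr d a \<in> ?M" for d
  proof (cases "d < m")
    case True
    then show ?thesis using low zero_in by simp
  next
    case False
    then show ?thesis using up[of "nat (d - m + 1)"] by simp
  qed
  then have "\<exists>c. c \<in> laurent_ring r u \<and> pr d a = (1 + u l) * c" for d by blast
  then obtain g where g: "\<And>d. g d \<in> laurent_ring r u" "\<And>d. pr d a = (1 + u l) * g d"
    by metis
  show ?thesis
  proof
    have "(\<Sum>d\<in>D. pr d a) = (1 + u l) * (\<Sum>d\<in>D. g d)"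
      by (simp only: g(2) sum_distrib_left)
    then show "a = (1 + u l) * (\<Sum>d\<in>D. g d)" using D(3) by (rule trans[rotated])
    show "(\<Sum>d\<in>D. g d) \<in> laurent_ring r u" by (intro laurent_sum g(1))
  qed
qed

text \<open>
  \<open>u\<close>, \<open>v\<close>, \<open>s\<close> are consecutive Y-clusters, \<open>v\<close> having exchange matrix \<open>C\<close>, and \<open>u'\<close> is the
  other neighbour of \<open>u\<close> in direction \<open>l\<close>.
\<close>

locale mutation_path =
  fixes r :: nat and C :: "nat \<Rightarrow> nat \<Rightarrow> int" and k l :: nat
    and u u' v s :: "nat \<Rightarrow> 'a::field_char_0"
  assumes kl: "k \<in> {1..r}" "l \<in> {1..r}" "k \<noteq> l"
    and skew: "sign_skew r C"
    and indep_u: "algebraically_independent r u" and indep_u': "algebraically_independent r u'"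
    and indep_v: "algebraically_independent r v" and indep_s: "algebraically_independent r s"
    and mut_vu: "Y_mutation r C k v u"
    and mut_sv: "Y_mutation r (mutate l C) l s v"
    and mut_uu': "Y_mutation r (mutate k C) l u u'"
begin

section \<open>The two denominators \<open>p\<close> and \<open>1 + w\<close> over the Laurent ring
  of \<open>s\<close>\<close>

abbreviation "L \<equiv> laurent_ring r s"

definition "p = 1 + s l"
text \<open>The exponent of \<open>v k\<close> is chosen so that \<open>p\<close> occurs in \<open>w\<close> to a nonnegative power.\<close>

definition "w = (if C l k \<ge> 0 then v k else inverse (v k))"

lemmas C = sign_skewD[OF skew]

lemma s_nonzero: "i \<in> {1..r} \<Longrightarrow> s i \<noteq> 0"
  by (rule algebraically_independent_nonzero[OF indep_s])

lemma v_nonzero: "i \<in> {1..r} \<Longrightarrow> v i \<noteq> 0"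
  by (rule algebraically_independent_nonzero[OF indep_v])

lemma p_nonzero: "p \<noteq> 0"
  unfolding p_def by (rule one_plus_gen_nonzero[OF indep_s kl(2)])

lemma succ_w_nonzero: "1 + w \<noteq> 0"
proof (cases "C l k \<ge> 0")
  case True
  then show ?thesis using one_plus_gen_nonzero[OF indep_v kl(1)] by (simp add: w_def)
next
  case False
  then have "(1 + w) * v k = 1 + v k" using v_nonzero[OF kl(1)] by (simp add: w_def distrib_right)
  then show ?thesis using one_plus_gen_nonzero[OF indep_v kl(1)] by auto
qed

lemma p_in: "p \<in> L"
  unfolding p_def using kl(2) by (intro laurent_add laurent_ring.one laurent_ring.gen)

lemma v_eq:
  assumes "j \<in> {1..r} - {l}"
  shows "v j = s j * s l ^ nat (- C l j) * p powi C l j"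
  using mut_sv assms by (simp add: Y_mutation_def mutate_def p_def)

lemma v_l: "v l = inverse (s l)"
  using mut_sv by (simp add: Y_mutation_def)

lemma w_eq: "\<exists>g\<in>L. w = p ^ nat \<bar>C l k\<bar> * g \<and> (C l k = 0 \<longrightarrow> g = s k)"
proof (cases "C l k \<ge> 0")
  case True
  have "v k = s k * s l ^ nat (- C l k) * p powi C l k" using kl by (intro v_eq) simp
  with True have "w = p ^ nat \<bar>C l k\<bar> * s k" by (simp add: w_def power_int_nonneg_exp mult.commute)
  moreover have "s k \<in> L" by (rule laurent_ring.gen[OF kl(1)])
  ultimately show ?thesis by (intro bexI[of _ "s k"]) simp_all
next
  case False
  let ?g = "inverse (s k) * inverse (s l) ^ nat (- C l k)"
  have "v k = s k * s l ^ nat (- C l k) * p powi C l k" using kl by (intro v_eq) simp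
  with False have "w = p ^ nat \<bar>C l k\<bar> * ?g" by (simp add: w_def power_int_def power_inverse mult.commute)
  moreover have "?g \<in> L"
    by (intro laurent_ring.mult laurent_power laurent_ring.inv_gen kl)
  ultimately show ?thesis using False by (intro bexI[of _ ?g]) simp_all
qed

lemma w_in: "w \<in> L"
proof -
  obtain g where "g \<in> L" "w = p ^ nat \<bar>C l k\<bar> * g" using w_eq by blast
  then show ?thesis using p_in by (simp add: laurent_ring.mult laurent_power)
qed

lemma w_p_multiple:
  assumes "C l k \<noteq> 0"
  shows "\<exists>g\<in>L. w = p * g"
proof -
  obtain g where g: "g \<in> L" "w = p ^ nat \<bar>C l k\<bar> * g" using w_eq by blast
  obtain n where "nat \<bar>C l k\<bar> = Suc n" using assms by (cases "nat \<bar>C l k\<bar>") auto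
  then have "w = p * (p ^ n * g)" using g(2) by simp
  moreover have "p ^ n * g \<in> L" using g(1) p_in by (intro laurent_ring.mult laurent_power)
  ultimately show ?thesis by blast
qed

lemma succ_w_in: "1 + w \<in> L"
  by (intro laurent_add laurent_ring.one w_in)

text \<open>Either \<open>p\<close> divides \<open>w\<close>, or \<open>w\<close> is the variable \<open>s k\<close>.\<close>

lemma succ_w_p_coprime:
  assumes a: "a \<in> L" and b: "b \<in> L" and ab: "(1 + w) * a = p * b"
  shows "\<exists>b'\<in>L. a = p * b'"
proof (cases "C l k = 0")
  case True
  then have "w = s k" using w_eq by auto
  then show ?thesis using succ_gens_coprime[OF indep_s kl a b] ab by (simp add: p_def)
next
  case False
  then obtain g where g: "g \<in> L" "w = p * g" using w_p_multiple by blast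
  show ?thesis
  proof
    show "a = p * (b - g * a)" using ab g(2) by (simp add: algebra_simps)
    show "b - g * a \<in> L" by (intro laurent_ring.diff laurent_ring.mult a b g)
  qed
qed

text \<open>Since \<open>p\<close> and \<open>1 + w\<close> are coprime, an element cleared both by
  a power of one and by a power of the other has no denominator. One factor \<open>p\<close> is
  removed at a time.\<close>

lemma intersection:
  assumes "(1 + w) ^ Q * e \<in> L" "p ^ P * e \<in> L"
  shows "e \<in> L"
  using assms(2)
proof (induction P)
  case (Suc P)
  \<comment> \<open>Descending induction from \<open>Q\<close> to 0: the claim for
    \<open>Suc n\<close> exhibits \<open>(1 + w) * ((1 + w) ^ n * (p ^ Suc P * e))\<close> as a
    multiple of \<open>p\<close>, and coprimality removes the first factor
    \<open>1 + w\<close>.\<close>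
  have "(1 + w) ^ n * (p ^ P * e) \<in> L" if "n \<le> Q" for n
    using that
  proof (induction rule: inc_induct)
    case base
    have "p ^ P * ((1 + w) ^ Q * e) \<in> L" by (intro laurent_ring.mult laurent_power p_in assms(1))
    then show ?case by (simp only: mult_ac)
  next
    case (step n)
    have "(1 + w) ^ n * (p ^ Suc P * e) \<in> L"
      by (intro laurent_ring.mult[OF _ Suc.prems] laurent_power succ_w_in)
    moreover have "(1 + w) * ((1 + w) ^ n * (p ^ Suc P * e)) = p * ((1 + w) ^ Suc n * (p ^ P * e))"
      by (simp add: mult_ac)
    ultimately obtain b' where "b' \<in> L" "(1 + w) ^ n * (p ^ Suc P * e) = p * b'"
      using succ_w_p_coprime step.IH by blast
    then show ?case using p_nonzero by (simp add: mult.left_commute)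
  qed
  from this[of 0] Suc.IH show ?case by simp
qed simp

text \<open>Each \<open>v i\<close> and its inverse is a monomial in \<open>s\<close> times an
  integer power of \<open>p\<close>.\<close>

lemma p_localisation:
  assumes "e \<in> laurent_ring r v"
  shows "e \<in> laurent_localisation r s p"
proof -
  note R = localisation_mult[OF p_in] localisation_powi[OF p_in] localisation_power[OF p_in]
    localisation_of_laurent[OF p_in]
  have p_powi: "p powi n \<in> laurent_localisation r s p" for n
    by (intro R p_in localisation_inverse[OF p_in] p_nonzero)
  have v_eq': "v i = (if i = l then inverse (s l) else s i * s l ^ nat (- C l i) * p powi C l i)"
    if "i \<in> {1..r}" for i using that v_eq[of i] v_l by auto
  have inv_v_eq: "inverse (v i) = (if i = l then s l else inverse (s i) * inverse (s l) ^ nat (- C l i) * p powi - C l i)"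
    if "i \<in> {1..r}" for i by (simp add: v_eq'[OF that] power_inverse power_int_minus)
  show ?thesis
    using assms
  proof induction
    case (gen i)
    have "s i * s l ^ nat (- C l i) * p powi C l i \<in> laurent_localisation r s p"
      by (intro R(1) p_powi R(3,4) laurent_ring.gen kl gen)
    then show ?case using laurent_ring.inv_gen[OF kl(2), of s] by (simp add: v_eq'[OF gen] R)
  next
    case (inv_gen i)
    have "inverse (s i) * inverse (s l) ^ nat (- C l i) * p powi - C l i \<in> laurent_localisation r s p"
      by (intro R(1) p_powi R(3,4) laurent_ring.inv_gen kl inv_gen)
    then show ?case using laurent_ring.gen[OF kl(2), of s] by (simp add: inv_v_eq[OF inv_gen] R)
  qed (simp_all add: R laurent_ring.one localisation_diff[OF p_in])
qed

section \<open>Orders along \<open>p\<close> after inverting \<open>1 + w\<close>\<close>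

abbreviation "R \<equiv> laurent_localisation r s (1 + w)"

lemmas R_of_L = localisation_of_laurent[OF succ_w_in]
lemmas R_mult = localisation_mult[OF succ_w_in]
lemmas R_diff = localisation_diff[OF succ_w_in]
lemmas R_power = localisation_power[OF succ_w_in]
lemmas R_sum = localisation_sum[OF succ_w_in]

text \<open>\<open>g\<close> is \<open>p powi d\<close> times a unit of \<open>R\<close>.\<close>

definition order_unit :: "int \<Rightarrow> 'a \<Rightarrow> bool" where
  "order_unit d g \<longleftrightarrow> g \<noteq> 0 \<and> p powi (- d) * g \<in> R \<and> p powi d * inverse g \<in> R"

lemma order_unit_mult:
  assumes "order_unit d g" "order_unit d' g'"
  shows "order_unit (d + d') (g * g')"
proof -
  have "(p powi (- d) * g) * (p powi (- d') * g') \<in> R"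
    by (rule R_mult) (use assms in \<open>simp_all add: order_unit_def\<close>)
  moreover have "(p powi d * inverse g) * (p powi d' * inverse g') \<in> R"
    by (rule R_mult) (use assms in \<open>simp_all add: order_unit_def\<close>)
  moreover have "(p powi (- d) * g) * (p powi (- d') * g') = p powi (- (d + d')) * (g * g')"
    "(p powi d * inverse g) * (p powi d' * inverse g') = p powi (d + d') * inverse (g * g')"
    using p_nonzero power_int_add[of p "- d" "- d'"] power_int_add[of p d d'] by (simp_all add: mult_ac)
  ultimately show ?thesis using assms by (simp add: order_unit_def)
qed

lemma order_unit_one: "order_unit 0 1"
  by (simp add: order_unit_def R_of_L laurent_ring.one)

lemma order_unit_inverse: "order_unit d g \<Longrightarrow> order_unit (- d) (inverse g)"
  by (simp add: order_unit_def)

lemma order_unit_power: "order_unit d g \<Longrightarrow> order_unit (d * int n) (g ^ n)"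
proof (induction n)
  case (Suc n)
  then show ?case using order_unit_mult[of d g "d * int n" "g ^ n"] by (simp add: distrib_left)
qed (simp add: order_unit_one)

lemma order_unit_powi:
  assumes "order_unit d g"
  shows "order_unit (d * n) (g powi n)"
proof (cases "n \<ge> 0")
  case True
  then show ?thesis using order_unit_power[OF assms, of "nat n"] by (simp add: power_int_nonneg_exp)
next
  case False
  then show ?thesis using order_unit_power[OF order_unit_inverse[OF assms], of "nat (- n)"]
    by (simp add: power_int_def)
qed

lemma order_unit_prod:
  assumes "\<And>i. i \<in> I \<Longrightarrow> order_unit (d i) (g i)"
  shows "order_unit (\<Sum>i\<in>I. d i) (\<Prod>i\<in>I. g i)"
  using assms by (induction I rule: infinite_finite_induct) (simp_all add: order_unit_one order_unit_mult)

lemma order_unit_s: "i \<in> {1..r} \<Longrightarrow> order_unit 0 (s i)"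
  using s_nonzero by (simp add: order_unit_def R_of_L laurent_ring.gen laurent_ring.inv_gen)

lemma order_unit_p: "order_unit 1 p"
  using p_nonzero by (simp add: order_unit_def R_of_L laurent_ring.one power_int_minus)

lemma order_unit_succ_w: "order_unit 0 (1 + w)"
  using succ_w_nonzero
  by (simp add: order_unit_def R_of_L succ_w_in localisation_inverse[OF succ_w_in])

lemma order_unit_v:
  assumes "j \<in> {1..r}"
  shows "order_unit (C l j) (v j)"
proof (cases "j = l")
  case True
  then show ?thesis using order_unit_inverse[OF order_unit_s[OF kl(2)]] C(1)[OF kl(2,2)] by (simp add: v_l)
next
  case False
  have "order_unit (0 + 0 * int (nat (- C l j)) + 1 * C l j) (s j * s l ^ nat (- C l j) * p powi C l j)"
    by (intro order_unit_mult order_unit_power order_unit_powi order_unit_p order_unit_s assms kl)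
  then show ?thesis using v_eq[of j] assms False by simp
qed

text \<open>If \<open>v k\<close> has negative order, then \<open>1 + v k = (1 + w) * v k\<close>
  inherits that order; otherwise \<open>1 + v k\<close> is the unit \<open>1 + w\<close>.\<close>

lemma order_unit_succ_v: "order_unit (min (C l k) 0) (1 + v k)"
proof (cases "C l k \<ge> 0")
  case True
  then show ?thesis using order_unit_succ_w by (simp add: w_def)
next
  case False
  then have "1 + v k = (1 + w) * v k" using v_nonzero[OF kl(1)] by (simp add: w_def field_simps)
  then show ?thesis using False order_unit_mult[OF order_unit_succ_w order_unit_v[OF kl(1)]] by simp
qed

lemma u_k: "u k = inverse (v k)"
  using mut_vu by (simp add: Y_mutation_def)

lemma u_eq:
  assumes "j \<in> {1..r} - {k}"
  shows "u j = v j * v k ^ nat (C k j) * (1 + v k) powi - C k j"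
  using mut_vu assms by (simp add: Y_mutation_def)

text \<open>The Y-mutation rule gives \<open>u j\<close> the order
  \<open>C l j + C l k * max (C k j) 0 - min (C l k) 0 * C k j\<close>, which is matrix mutation in
  row \<open>l\<close>. Thus the orders are again the entries of row \<open>l\<close>, now of the
  matrix at \<open>u\<close>.\<close>

lemma order_unit_u:
  assumes "j \<in> {1..r}"
  shows "order_unit (mutate k C l j) (u j)"
proof (cases "j = k")
  case True
  then show ?thesis using order_unit_inverse[OF order_unit_v[OF kl(1)]] by (simp add: u_k mutate_def)
next
  case False
  have "order_unit (C l j + C l k * int (nat (C k j)) + min (C l k) 0 * (- C k j))
      (v j * v k ^ nat (C k j) * (1 + v k) powi - C k j)"
    by (intro order_unit_mult order_unit_power order_unit_powi order_unit_v order_unit_succ_v assms kl)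
  moreover have "C l j + C l k * int (nat (C k j)) + min (C l k) 0 * (- C k j) = mutate k C l j"
    using False kl(3) by (auto simp: mutate_def max_def min_def algebra_simps)
  ultimately show ?thesis using u_eq[of j] False assms by simp
qed

lemma order_unit_monomial: "order_unit (weight r (mutate k C l) n) (monomial r u n)"
  unfolding weight_def monomial_def
  by (intro order_unit_prod order_unit_powi order_unit_u)

text \<open>Here \<open>p\<close> divides \<open>w\<close>, so \<open>1 + w\<close> is 1 modulo
  \<open>p\<close>.\<close>

lemma succ_w_power: "C l k \<noteq> 0 \<Longrightarrow> \<exists>g\<in>L. (1 + w) ^ n - 1 = p * g"
proof (induction n)
  case 0
  show ?case by (intro bexI[of _ 0]) simp_all
next
  case (Suc n)
  then obtain g g' where g: "g \<in> L" "(1 + w) ^ n = 1 + p * g" and g': "g' \<in> L" "w = p * g'"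
    using w_p_multiple by (auto simp: algebra_simps)
  have "(1 + w) ^ Suc n - 1 = p * (g' * (1 + w) ^ n + g)"
    by (simp add: algebra_simps g(2)) (simp add: g'(2) algebra_simps)
  moreover have "g' * (1 + w) ^ n + g \<in> L"
    by (intro laurent_add laurent_ring.mult laurent_power succ_w_in g g')
  ultimately show ?case by blast
qed

text \<open>Modulo \<open>p\<close> one has \<open>s l = -1\<close> and
  \<open>(1 + w) ^ N = 1\<close>, while \<open>u l\<close> is \<open>inverse (s l)\<close> times
  \<open>(1 + w) ^ N\<close> or its inverse. Hence \<open>u l\<close> is -1 modulo \<open>p\<close>,
  which ties the divisor \<open>1 + u l\<close> of the mutation at \<open>u\<close> to
  \<open>p\<close>.\<close>

lemma succ_u_l: "\<exists>\<rho>\<in>R. 1 + u l = p * \<rho>"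
proof -
  define N where "N = nat \<bar>C k l\<bar>"
  have "\<exists>g\<in>L. (1 + w) ^ N - 1 = p * g"
  proof (cases "C l k = 0")
    case True
    then have "N = 0" using C(4)[OF kl(2,1)] by (simp add: N_def)
    then show ?thesis by (intro bexI[of _ 0]) simp_all
  qed (rule succ_w_power)
  then obtain g where g: "g \<in> L" "(1 + w) ^ N = 1 + p * g" by (auto simp: algebra_simps)
  have l: "l \<in> {1..r} - {k}" using kl by auto
  show ?thesis
  proof (cases "C l k \<ge> 0")
    case True
    then have neg: "C k l \<le> 0" using C(2)[OF kl(1,2)] by linarith
    then have "u l = inverse (s l) * (1 + w) ^ N"
      using u_eq[OF l] True by (simp add: v_l w_def N_def power_int_nonneg_exp)
    then have "1 + u l = p * (inverse (s l) * (1 + g))"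
      using s_nonzero[OF kl(2)] by (simp add: g(2) p_def field_simps)
    moreover have "inverse (s l) * (1 + g) \<in> R"
      by (intro R_of_L laurent_ring.mult laurent_add laurent_ring.one g laurent_ring.inv_gen kl)
    ultimately show ?thesis by blast
  next
    case False
    then have pos: "C k l > 0" using C(3)[OF kl(2,1)] by simp
    have sv: "1 + v k = (1 + w) * v k" using False v_nonzero[OF kl(1)] by (simp add: w_def field_simps)
    have "u l = inverse (s l) * (v k ^ N * inverse (((1 + w) * v k) ^ N))"
      using u_eq[OF l] pos by (simp add: sv v_l N_def power_int_def power_inverse power_mult_distrib)
    also have "\<dots> = inverse (s l) * inverse ((1 + w) ^ N)"
      using v_nonzero[OF kl(1)] by (simp add: power_mult_distrib)
    finally have "u l = inverse (s l) * inverse ((1 + w) ^ N)" .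
    then have "1 + u l = inverse (s l) * inverse (1 + w) ^ N * (s l * (1 + w) ^ N + 1)"
      using s_nonzero[OF kl(2)] succ_w_nonzero by (simp add: power_inverse field_simps)
    also have "\<dots> = p * (inverse (s l) * inverse (1 + w) ^ N * (1 + s l * g))"
      by (simp add: g(2) p_def algebra_simps)
    finally have "1 + u l = p * (inverse (s l) * inverse (1 + w) ^ N * (1 + s l * g))" .
    moreover have "inverse (s l) * inverse (1 + w) ^ N * (1 + s l * g) \<in> R"
      by (intro R_mult R_power localisation_inverse[OF succ_w_in] succ_w_nonzero R_of_L laurent_add
          laurent_ring.one laurent_ring.mult laurent_ring.gen laurent_ring.inv_gen g kl)
    ultimately show ?thesis by blast
  qed
qed

text \<open>A monomial of weight \<open>d\<close> is \<open>p powi d\<close> times a unit of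
  \<open>R\<close>, which settles the components with \<open>d \<ge> 0\<close>. For
  \<open>d < 0\<close> the Laurent property in \<open>u'\<close> provides a factor
  \<open>(1 + u l) ^ nat (- d)\<close>, whose powers of \<open>p\<close> compensate the negative
  order.\<close>

lemma w_localisation:
  assumes e: "e \<in> laurent_ring r u" "e \<in> laurent_ring r u'"
  shows "e \<in> R"
proof -
  let ?\<omega> = "mutate k C l"
  \<comment> \<open>Both correction products in the mutated diagonal entry vanish, as
    \<open>C l k\<close> and \<open>C k l\<close> have opposite signs or are both 0.\<close>
  have ll: "mutate k C l l = 0"
    using kl C(1)[OF kl(2,2)] C(2,3)[OF kl(1,2)] by (auto simp: mutate_def max_def)
  obtain pr where pr: "weight_projection r u ?\<omega> pr"
    by (rule weight_projection_exists[OF indep_u])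
  interpret weight_projection r u ?\<omega> pr by (rule pr)
  obtain \<rho> where \<rho>: "\<rho> \<in> R" "1 + u l = p * \<rho>" using succ_u_l by blast
  have homogeneous: "p powi (- d) * pr d a \<in> R" if "a \<in> laurent_ring r u" for a d
    using that nonzero
  proof (induction rule: laurent_additive_induct)
    case (mono n)
    then show ?case using order_unit_monomial[of n]
      by (auto simp: pr_mono order_unit_def R_of_L)
  next
    case (diff a b)
    then show ?case by (simp add: pr_diff right_diff_distrib R_diff)
  qed
  have "pr d e \<in> R" for d
  proof (cases "d \<ge> 0")
    case True
    have "p powi d * (p powi (- d) * pr d e) \<in> R"
      using True by (intro R_mult homogeneous e) (simp add: power_int_nonneg_exp R_of_L laurent_power p_in)
    moreover have "p powi d * (p powi (- d) * pr d e) = pr d e"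
      using p_nonzero by (simp add: power_int_minus mult.assoc[symmetric])
    ultimately show ?thesis by simp
  next
    case False
    have nz': "\<forall>i\<in>{1..r}. u' i \<noteq> 0" by (intro ballI algebraically_independent_nonzero[OF indep_u'])
    obtain b where b: "b \<in> laurent_ring r u" "pr d e = (1 + u l) powi (- d) * b"
      using weight_component_mutated[OF mut_uu' indep_u nz' kl(2) ll pr e] by blast
    \<comment> \<open>The cofactor \<open>b\<close> may be inhomogeneous; projecting once more
      replaces it by \<open>pr d b\<close>, to which \<open>homogeneous\<close> applies.\<close>
    have "pr d e = pr d (pr d e)" using idem[OF e(1)] by simp
    also have "\<dots> = (1 + u l) ^ nat (- d) * pr d b"
      using False succ_gen_power_mult[OF b(1) kl(2) ll] by (simp add: b(2) power_int_def)
    also have "\<dots> = \<rho> ^ nat (- d) * (p powi (- d) * pr d b)"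
      using False by (simp add: \<rho>(2) power_mult_distrib power_int_def)
    also have "\<dots> \<in> R" by (intro R_mult R_power \<rho> homogeneous b)
    finally show ?thesis .
  qed
  moreover obtain D where "e = (\<Sum>d\<in>D. pr d e)" using sum_eq[OF e(1)] by blast
  ultimately show ?thesis using R_sum[of D "\<lambda>d. pr d e"] by simp
qed

text \<open>The clusters \<open>u\<close> and \<open>u'\<close> together leave only powers of
  \<open>1 + w\<close> in the denominator, and \<open>v\<close> leaves only powers of
  \<open>p\<close>.\<close>

lemma laurent_propagates:
  assumes "e \<in> laurent_ring r u" "e \<in> laurent_ring r u'" "e \<in> laurent_ring r v"
  shows "e \<in> laurent_ring r s"
proof -
  obtain Q where "(1 + w) ^ Q * e \<in> L"
    using w_localisation[OF assms(1,2)] by (auto simp: laurent_localisation_def)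
  moreover obtain P where "p ^ P * e \<in> L"
    using p_localisation[OF assms(3)] by (auto simp: laurent_localisation_def)
  ultimately show ?thesis by (rule intersection)
qed

end

section \<open>Specialisation along the tree\<close>

text \<open>Induction based at any vertex: the property is carried along edges from \<open>t\<close>
  to the root and from there to \<open>s\<close>.\<close>

lemma tree_induct:
  assumes s: "s \<in> tree_vertices r" and t: "t \<in> tree_vertices r" and base: "P t"
    and step: "\<And>s k. s \<in> tree_vertices r \<Longrightarrow> k \<in> {1..r} \<Longrightarrow> P s \<Longrightarrow> P (neighbour s k)"
  shows "P s"
proof -
  have "P []" using t base
  proof (induction t)
    case (Cons a t)
    then have "a \<in> {1..r}" "t \<in> tree_vertices r"
      by (auto simp: tree_vertices_def distinct_adj_Cons)
    then show ?case using Cons.IH step[OF Cons.prems(1) _ Cons.prems(2), of a] by (simp add: neighbour_def)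
  qed
  then show ?thesis using s
  proof (induction s)
    case (Cons a s)
    then have a: "a \<in> {1..r}" "s \<in> tree_vertices r" and "neighbour s a = a # s"
      by (auto simp: tree_vertices_def distinct_adj_Cons neighbour_def)
    then show ?case using step[OF a(2,1)] Cons by simp
  qed
qed

text \<open>The partial extension of \<open>\<psi>\<close> to the fraction field: the specialisation is known to be Laurent
  only for the belt variables, not for the intermediate clusters.\<close>

definition specialises_to :: "nat \<Rightarrow> (nat \<Rightarrow> 'a::field) \<Rightarrow> ('a \<Rightarrow> int) \<Rightarrow> 'a \<Rightarrow> rat \<Rightarrow> bool" where
  "specialises_to r u \<psi> e c \<longleftrightarrow>
     (\<exists>a\<in>laurent_ring r u. \<exists>b\<in>laurent_ring r u. \<psi> b \<noteq> 0 \<and> e = a / b \<and> c = of_int (\<psi> a) / of_int (\<psi> b))"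

context
  fixes r :: nat and u :: "nat \<Rightarrow> 'a::field" and \<psi> :: "'a \<Rightarrow> int"
  assumes \<psi>: "unit_specialisation r u \<psi>"
begin

lemma psi_one: "\<psi> 1 = 1"
  using \<psi> by (simp add: unit_specialisation_def)

lemma psi_add: "a \<in> laurent_ring r u \<Longrightarrow> b \<in> laurent_ring r u \<Longrightarrow> \<psi> (a + b) = \<psi> a + \<psi> b"
  using \<psi> by (simp add: unit_specialisation_def)

lemma psi_mult: "a \<in> laurent_ring r u \<Longrightarrow> b \<in> laurent_ring r u \<Longrightarrow> \<psi> (a * b) = \<psi> a * \<psi> b"
  using \<psi> by (simp add: unit_specialisation_def)

lemma psi_nonzero: "\<psi> b \<noteq> 0 \<Longrightarrow> b \<noteq> 0"
  using psi_add[OF laurent_zero laurent_zero] by auto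

text \<open>A value computed through intermediate clusters is that of \<open>\<psi>\<close> once the
  element is known to be Laurent.\<close>

lemma specialises_to_unique:
  assumes "specialises_to r u \<psi> e c" "e \<in> laurent_ring r u"
  shows "c = of_int (\<psi> e)"
proof -
  obtain a b where ab: "a \<in> laurent_ring r u" "b \<in> laurent_ring r u" "\<psi> b \<noteq> 0" "e = a / b"
    "c = of_int (\<psi> a) / of_int (\<psi> b)"
    using assms(1) unfolding specialises_to_def by blast
  have "a = e * b" using ab(4) psi_nonzero[OF ab(3)] by simp
  then have "\<psi> a = \<psi> e * \<psi> b" using psi_mult[OF assms(2) ab(2)] by simp
  then show ?thesis using ab(3,5) by simp
qed

lemma specialises_to_gen:
  assumes "i \<in> {1..r}"
  shows "specialises_to r u \<psi> (u i) 1"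
  unfolding specialises_to_def using \<psi> assms
  by (intro bexI[of _ "u i"] bexI[of _ 1])
    (simp_all add: unit_specialisation_def laurent_ring.one laurent_ring.gen)

lemma specialises_to_one: "specialises_to r u \<psi> 1 1"
  unfolding specialises_to_def
  by (intro bexI[of _ 1]) (simp_all add: psi_one laurent_ring.one)

lemma specialises_to_mult:
  assumes "specialises_to r u \<psi> e c" "specialises_to r u \<psi> e' c'"
  shows "specialises_to r u \<psi> (e * e') (c * c')"
proof -
  obtain a b a' b' where ab: "a \<in> laurent_ring r u" "b \<in> laurent_ring r u" "\<psi> b \<noteq> 0" "e = a / b"
    "c = of_int (\<psi> a) / of_int (\<psi> b)"
    and ab': "a' \<in> laurent_ring r u" "b' \<in> laurent_ring r u" "\<psi> b' \<noteq> 0" "e' = a' / b'"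
    "c' = of_int (\<psi> a') / of_int (\<psi> b')"
    using assms unfolding specialises_to_def by blast
  show ?thesis
    unfolding specialises_to_def
    by (intro bexI[of _ "a * a'"] bexI[of _ "b * b'"])
      (use ab ab' in \<open>simp_all add: psi_mult laurent_ring.mult\<close>)
qed

lemma specialises_to_add:
  assumes "specialises_to r u \<psi> e c" "specialises_to r u \<psi> e' c'"
  shows "specialises_to r u \<psi> (e + e') (c + c')"
proof -
  obtain a b a' b' where ab: "a \<in> laurent_ring r u" "b \<in> laurent_ring r u" "\<psi> b \<noteq> 0" "e = a / b"
    "c = of_int (\<psi> a) / of_int (\<psi> b)"
    and ab': "a' \<in> laurent_ring r u" "b' \<in> laurent_ring r u" "\<psi> b' \<noteq> 0" "e' = a' / b'"
    "c' = of_int (\<psi> a') / of_int (\<psi> b')"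
    using assms unfolding specialises_to_def by blast
  have "b \<noteq> 0" "b' \<noteq> 0" using psi_nonzero ab(3) ab'(3) by blast+
  then have "e + e' = (a * b' + a' * b) / (b * b')" by (simp add: ab(4) ab'(4) add_frac_eq)
  moreover have "\<psi> (a * b' + a' * b) = \<psi> a * \<psi> b' + \<psi> a' * \<psi> b"
    using ab ab' by (simp add: psi_add psi_mult laurent_ring.mult)
  moreover have "c + c' = of_int (\<psi> a * \<psi> b' + \<psi> a' * \<psi> b) / of_int (\<psi> b * \<psi> b')"
    using ab(3) ab'(3) by (simp add: ab(5) ab'(5) add_frac_eq)
  ultimately show ?thesis
    unfolding specialises_to_def
    by (intro bexI[of _ "a * b' + a' * b"] bexI[of _ "b * b'"])
      (use ab ab' in \<open>simp_all add: psi_mult laurent_ring.mult laurent_add\<close>)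
qed

lemma specialises_to_inverse:
  assumes "specialises_to r u \<psi> e c" "c \<noteq> 0"
  shows "specialises_to r u \<psi> (inverse e) (inverse c)"
proof -
  obtain a b where ab: "a \<in> laurent_ring r u" "b \<in> laurent_ring r u" "\<psi> b \<noteq> 0" "e = a / b"
    "c = of_int (\<psi> a) / of_int (\<psi> b)"
    using assms(1) unfolding specialises_to_def by blast
  show ?thesis
    unfolding specialises_to_def
    by (intro bexI[of _ b] bexI[of _ a]) (use ab assms(2) in auto)
qed

lemma specialises_to_power:
  "specialises_to r u \<psi> e c \<Longrightarrow> specialises_to r u \<psi> (e ^ n) (c ^ n)"
  by (induction n) (simp_all add: specialises_to_one specialises_to_mult)

lemma specialises_to_powi:
  "specialises_to r u \<psi> e c \<Longrightarrow> c \<noteq> 0 \<Longrightarrow> specialises_to r u \<psi> (e powi n) (c powi n)"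
  by (simp add: power_int_def specialises_to_power specialises_to_inverse)

lemma specialises_to_prod:
  "(\<And>i. i \<in> I \<Longrightarrow> specialises_to r u \<psi> (g i) (c i)) \<Longrightarrow> specialises_to r u \<psi> (prod g I) (prod c I)"
  by (induction I rule: infinite_finite_induct) (simp_all add: specialises_to_one specialises_to_mult)

end

text \<open>Column monomials are the Y-hat variables of cluster algebra theory. The exchange
  relation, rewritten as \<open>\<xi>' k * \<xi> k = M * (1 + \<eta> B \<xi> k)\<close>, is the
  source of the factor \<open>1 + \<eta> B \<xi> k\<close>; positivity keeps denominators
  nonzero.\<close>

lemma column_monomials_mutate:
  fixes \<xi> :: "nat \<Rightarrow> 'a::linordered_field" and r k :: nat and B :: "nat \<Rightarrow> nat \<Rightarrow> int"
  defines "\<eta> \<equiv> \<lambda>B \<xi> j. monomial r \<xi> (\<lambda>i. B i j)"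
  defines "\<xi>' \<equiv> \<xi>(k := ((\<Prod>i\<in>{1..r}. \<xi> i ^ nat (B i k)) + (\<Prod>i\<in>{1..r}. \<xi> i ^ nat (- B i k))) / \<xi> k)"
  assumes pos: "\<And>i. i \<in> {1..r} \<Longrightarrow> \<xi> i > 0" and k: "k \<in> {1..r}" and Bkk: "B k k = 0"
  shows "\<eta> (mutate k B) \<xi>' k = inverse (\<eta> B \<xi> k)"
    and "j \<noteq> k \<Longrightarrow> \<eta> (mutate k B) \<xi>' j = \<eta> B \<xi> j * \<eta> B \<xi> k ^ nat (B k j) * (1 + \<eta> B \<xi> k) powi (- B k j)"
proof -
  define P where "P = (\<Prod>i\<in>{1..r}. \<xi> i ^ nat (B i k))"
  define M where "M = (\<Prod>i\<in>{1..r}. \<xi> i ^ nat (- B i k))"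
  have PM: "P > 0" "M > 0" unfolding P_def M_def using pos by (auto intro!: prod_pos)
  have "\<eta> B \<xi> k = (\<Prod>i\<in>{1..r}. \<xi> i ^ nat (B i k) / \<xi> i ^ nat (- B i k))"
    unfolding \<eta>_def monomial_def by (intro prod.cong) (auto simp: power_int_def power_inverse divide_inverse)
  then have \<eta>k: "\<eta> B \<xi> k = P / M" by (simp add: P_def M_def prod_dividef)
  then have \<eta>k_pos: "\<eta> B \<xi> k > 0" using PM by simp
  have \<xi>'k: "\<xi>' k * \<xi> k = M * (1 + \<eta> B \<xi> k)"
  proof -
    have "\<xi>' k = (P + M) / \<xi> k" by (simp only: \<xi>'_def P_def M_def fun_upd_same)
    then show ?thesis using pos[OF k] PM by (simp add: \<eta>k field_simps)
  qed
  have \<xi>'_other: "\<xi>' i = \<xi> i" if "i \<noteq> k" for i using that by (simp add: \<xi>'_def)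
  have "\<eta> (mutate k B) \<xi>' k = (\<Prod>i\<in>{1..r}. inverse (\<xi> i powi B i k))"
    unfolding \<eta>_def monomial_def
  proof (intro prod.cong refl)
    fix i show "\<xi>' i powi mutate k B i k = inverse (\<xi> i powi B i k)"
      using Bkk by (cases "i = k") (simp_all add: mutate_def \<xi>'_other power_int_minus)
  qed
  then show "\<eta> (mutate k B) \<xi>' k = inverse (\<eta> B \<xi> k)"
    by (simp add: \<eta>_def monomial_def prod_inversef[symmetric] comp_def)
  assume jk: "j \<noteq> k"
  define b where "b = B k j"
  \<comment> \<open>\<open>h i\<close> is the contribution of \<open>\<xi> i\<close> to
    \<open>\<eta> B \<xi> j * P ^ nat b * inverse (M ^ nat (- b))\<close>. For
    \<open>i \<noteq> k\<close> it is also the factor with index \<open>i\<close> of the mutated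
    column monomial.\<close>
  define h where "h i = \<xi> i powi B i j * (\<xi> i ^ nat (B i k)) ^ nat b * inverse ((\<xi> i ^ nat (- B i k)) ^ nat (- b))" for i
  have "(\<Prod>i\<in>{1..r} - {k}. \<xi>' i powi mutate k B i j) = (\<Prod>i\<in>{1..r} - {k}. h i)"
  proof (intro prod.cong refl)
    fix i assume i: "i \<in> {1..r} - {k}"
    have "\<xi> i \<noteq> 0" using pos[of i] i by auto
    moreover have "mutate k B i j = B i j + int (nat (B i k) * nat b) - int (nat (- B i k) * nat (- b))"
      using i jk by (simp add: mutate_def b_def max_def)
    ultimately show "\<xi>' i powi mutate k B i j = h i"
      using i by (simp add: \<xi>'_other h_def power_int_add power_int_diff power_mult divide_inverse
          del: of_nat_mult)
  qed
  moreover have hk: "h k = \<xi> k powi b" by (simp add: h_def Bkk b_def)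
  moreover have "(\<Prod>i\<in>{1..r}. h i) = \<eta> B \<xi> j * P ^ nat b * inverse (M ^ nat (- b))"
    by (simp add: h_def \<eta>_def monomial_def P_def M_def prod.distrib prod_power_distrib prod_inversef[symmetric] comp_def)
  moreover have "(\<Prod>i\<in>{1..r}. h i) = h k * (\<Prod>i\<in>{1..r} - {k}. h i)"
    by (rule prod.remove) (use k in auto)
  moreover have "\<eta> (mutate k B) \<xi>' j = \<xi>' k powi (- b) * (\<Prod>i\<in>{1..r} - {k}. \<xi>' i powi mutate k B i j)"
    unfolding \<eta>_def monomial_def using k by (subst prod.remove[of _ k]) (auto simp: mutate_def b_def)
  moreover have divide: "a = x * inverse (\<xi> k powi b) * c" if "a * \<xi> k powi b = x * c" for a x c
  proof -
    have "\<xi> k powi b \<noteq> 0" using pos[OF k] by simp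
    then have "a = (a * \<xi> k powi b) * inverse (\<xi> k powi b)" by simp
    then show ?thesis unfolding that by (simp only: mult_ac)
  qed
  ultimately have "\<eta> (mutate k B) \<xi>' j * \<xi> k powi b = \<xi>' k powi (- b) * (\<eta> B \<xi> j * P ^ nat b * inverse (M ^ nat (- b)))"
    by (simp add: mult_ac)
  then have "\<eta> (mutate k B) \<xi>' j = (\<xi>' k * \<xi> k) powi (- b) * (\<eta> B \<xi> j * P ^ nat b * inverse (M ^ nat (- b)))"
    unfolding power_int_mult_distrib power_int_minus[of "\<xi> k"]
    by (rule divide)
  also have "\<dots> = \<eta> B \<xi> j * (P ^ nat b * (M powi (- b) * inverse (M ^ nat (- b)))) * (1 + \<eta> B \<xi> k) powi (- b)"
    by (simp add: \<xi>'k power_int_mult_distrib)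
  \<comment> \<open>The exponents \<open>- b\<close> and \<open>- nat (- b)\<close> of
    \<open>M\<close> add up to \<open>- nat b\<close>, matching \<open>P ^ nat b\<close> to form a
    power of \<open>P / M\<close>.\<close>
  also have "M powi (- b) * inverse (M ^ nat (- b)) = inverse (M ^ nat b)"
    using PM by (cases "b \<ge> 0") (simp_all add: power_int_def power_inverse)
  also have "P ^ nat b * inverse (M ^ nat b) = \<eta> B \<xi> k ^ nat b"
    by (simp add: \<eta>k power_divide divide_inverse power_inverse power_mult_distrib)
  finally show "\<eta> (mutate k B) \<xi>' j = \<eta> B \<xi> j * \<eta> B \<xi> k ^ nat (B k j) * (1 + \<eta> B \<xi> k) powi (- B k j)"
    by (simp add: b_def)
qed

text \<open>Since \<open>d i * max (B i k) 0 = d k * max (- B k i) 0\<close>, transposition turns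
  each of the two correction products into the other one.\<close>

lemma skew_symmetrisable_mutate:
  fixes d :: "nat \<Rightarrow> real"
  assumes d: "\<And>i. i \<in> {1..r} \<Longrightarrow> d i > 0"
    and B: "\<And>i j. i \<in> {1..r} \<Longrightarrow> j \<in> {1..r} \<Longrightarrow> d i * of_int (B i j) = - (d j * of_int (B j i))"
    and k: "k \<in> {1..r}" and ij: "i \<in> {1..r}" "j \<in> {1..r}"
  shows "d i * of_int (mutate k B i j) = - (d j * of_int (mutate k B j i))"
proof (cases "i = k \<or> j = k")
  case True
  then show ?thesis using B[OF ij] by (auto simp: mutate_def)
next
  case False
  have swap: "d p * of_int (max (B p q) 0) = d q * of_int (max (- B q p) 0)"
    "d p * of_int (max (- B p q) 0) = d q * of_int (max (B q p) 0)"
    if "p \<in> {1..r}" "q \<in> {1..r}" for p q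
  proof -
    have dd: "d p > 0" "d q > 0" using d that by auto
    have eq: "d p * of_int (B p q) = d q * of_int (- B q p)" using B[OF that] by simp
    have "B p q \<ge> 0 \<longleftrightarrow> - B q p \<ge> 0"
    proof -
      have "B p q \<ge> 0 \<longleftrightarrow> d p * of_int (B p q) \<ge> 0" using dd(1) by (simp add: zero_le_mult_iff)
      also have "\<dots> \<longleftrightarrow> - B q p \<ge> 0" unfolding eq using dd(2) by (simp add: zero_le_mult_iff mult_le_0_iff)
      finally show ?thesis .
    qed
    then show "d p * of_int (max (B p q) 0) = d q * of_int (max (- B q p) 0)"
      "d p * of_int (max (- B p q) 0) = d q * of_int (max (B q p) 0)"
      using eq by (auto simp: max_def)
  qed
  \<comment> \<open>The extra factor \<open>d k\<close> gives each of the two entries its own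
    symmetriser; it is cancelled afterwards.\<close>
  have "d k * (d i * (of_int (max (B i k) 0) * of_int (max (B k j) 0))) =
      (d i * of_int (max (B i k) 0)) * (d k * of_int (max (B k j) 0))" by simp
  also have "\<dots> = d k * (d j * (of_int (max (- B j k) 0) * of_int (max (- B k i) 0)))"
    unfolding swap(1)[OF ij(1) k] swap(1)[OF k ij(2)] by simp
  finally have 1: "d i * (of_int (max (B i k) 0) * of_int (max (B k j) 0)) =
      d j * (of_int (max (- B j k) 0) * of_int (max (- B k i) 0))"
    using d[OF k] by simp
  have "d k * (d i * (of_int (max (- B i k) 0) * of_int (max (- B k j) 0))) =
      (d i * of_int (max (- B i k) 0)) * (d k * of_int (max (- B k j) 0))" by simp
  also have "\<dots> = d k * (d j * (of_int (max (B j k) 0) * of_int (max (B k i) 0)))"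
    unfolding swap(2)[OF ij(1) k] swap(2)[OF k ij(2)] by simp
  finally have 2: "d i * (of_int (max (- B i k) 0) * of_int (max (- B k j) 0)) =
      d j * (of_int (max (B j k) 0) * of_int (max (B k i) 0))"
    using d[OF k] by simp
  show ?thesis using False B[OF ij] 1 2
    by (simp add: mutate_def distrib_left right_diff_distrib del: of_int_max)
qed

text \<open>Mutation need not preserve sign-skewness by itself, but it preserves the symmetriser
  \<open>d\<close> of \<open>A\<close>; the induction keeps track of \<open>d\<close> and passes to
  signs at the end.\<close>

lemma B_at_sign_skew:
  assumes A: "symmetrisable_gcm r A" and s: "s \<in> tree_vertices r"
  shows "sign_skew r (B_at A s)"
proof -
  obtain d :: "nat \<Rightarrow> real" where d: "\<And>i. i \<in> {1..r} \<Longrightarrow> d i > 0"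
    and dA: "\<And>i j. i \<in> {1..r} \<Longrightarrow> j \<in> {1..r} \<Longrightarrow> d i * of_int (A i j) = d j * of_int (A j i)"
    using A unfolding symmetrisable_gcm_def by blast
  have "\<forall>i\<in>{1..r}. \<forall>j\<in>{1..r}. d i * of_int (B_at A s i j) = - (d j * of_int (B_at A s j i))"
    using s
  proof (induction s)
    case Nil
    show ?case using dA by (simp add: B_init_def)
  next
    case (Cons k s)
    have k: "k \<in> {1..r}" and "s \<in> tree_vertices r"
      using Cons.prems by (auto simp: tree_vertices_def distinct_adj_Cons)
    note IH = Cons.IH[OF this(2)]
    show ?case
    proof (intro ballI)
      fix i j assume ij: "i \<in> {1..r}" "j \<in> {1..r}"
      show "d i * of_int (B_at A (k # s) i j) = - (d j * of_int (B_at A (k # s) j i))"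
        unfolding B_at.simps
      proof (rule skew_symmetrisable_mutate)
        show "d i * of_int (B_at A s i j) = - (d j * of_int (B_at A s j i))"
          if "i \<in> {1..r}" "j \<in> {1..r}" for i j using IH that by blast
      qed (fact d k ij)+
    qed
  qed
  moreover have sgn: "sgn b = - sgn c" if "x > 0" "y > 0" "x * of_int b = - (y * of_int c)" for x y :: real and b c :: int
  proof -
    have "sgn (x * of_int b) = - sgn (y * of_int c)" using that(3) by (simp add: sgn_minus)
    then have "sgn (of_int b :: real) = - sgn (of_int c)" using that(1,2) by (simp add: sgn_mult)
    then show ?thesis by (auto simp: sgn_if split: if_splits)
  qed
  ultimately have "sgn (B_at A s i j) = - sgn (B_at A s j i)" if "i \<in> {1..r}" "j \<in> {1..r}" for i j
    using sgn[OF d[OF that(1)] d[OF that(2)]] that by blast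
  then show ?thesis unfolding sign_skew_def by blast
qed

section \<open>The belt\<close>

lemma belt_in_tree: "r \<ge> 1 \<Longrightarrow> belt r i m \<in> tree_vertices r"
  by (simp add: belt_def belt_walk_in_tree)

text \<open>The steps are equivalences so that the induction reaches negative rows as well.\<close>

lemma belt_induct:
  fixes P :: "nat \<Rightarrow> int \<Rightarrow> bool"
  assumes i: "i \<in> {1..r}" and start: "P 1 0"
    and step: "\<And>i m. 1 \<le> i \<Longrightarrow> i < r \<Longrightarrow> P i m \<longleftrightarrow> P (Suc i) m"
    and wrap: "\<And>m. P r m \<longleftrightarrow> P 1 (m + 1)"
  shows "P i m"
proof -
  have row: "P i m \<longleftrightarrow> P 1 m" if "i \<in> {1..r}" for i m
  proof -
    have "1 \<le> i" using that by simp
    then show ?thesis using that step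
    proof (induction i rule: dec_induct)
      case (step n)
      then show ?case by simp
    qed simp
  qed
  have next_row: "P 1 m \<longleftrightarrow> P 1 (m + 1)" for m
    using row[of r m] wrap[of m] i by simp
  have "P 1 m"
  proof (induction m rule: int_induct[where k = 0])
    case base
    show ?case by (rule start)
  next
    case (step1 m)
    then show ?case using next_row by simp
  next
    case (step2 m)
    then show ?case using next_row[of "m - 1"] by simp
  qed
  then show ?thesis using row[OF i] by simp
qed

section \<open>Exchange matrices along the belt\<close>

definition cyclic_rank :: "nat \<Rightarrow> nat \<Rightarrow> nat \<Rightarrow> nat" where
  "cyclic_rank r i p = (if p < i then p + r else p)"

text \<open>The exchange matrix at \<open>belt r i m\<close> is \<open>B_init\<close> for the order \<open>i < \<dots> < r < 1 < \<dots> < i - 1\<close>.\<close>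

definition belt_matrix :: "nat \<Rightarrow> (nat \<Rightarrow> nat \<Rightarrow> int) \<Rightarrow> nat \<Rightarrow> (nat \<Rightarrow> nat \<Rightarrow> int) \<Rightarrow> bool" where
  "belt_matrix r A i M \<longleftrightarrow> (\<forall>p\<in>{1..r}. \<forall>q\<in>{1..r}. M p q =
     (if cyclic_rank r i p < cyclic_rank r i q then A p q
      else if cyclic_rank r i p > cyclic_rank r i q then - A p q else 0))"

text \<open>When \<open>i\<close> comes first, column \<open>i\<close> is nonnegative and row
  \<open>i\<close> nonpositive, so the correction products vanish and mutation only negates row and
  column \<open>i\<close>. This moves \<open>i\<close> from the first place to the last; the second
  claim is the reverse move.\<close>

lemma belt_matrix_mutate:
  assumes A: "\<And>p q. p \<in> {1..r} \<Longrightarrow> q \<in> {1..r} \<Longrightarrow> p \<noteq> q \<Longrightarrow> A p q \<le> 0"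
    and i: "i \<in> {1..r}"
  shows "belt_matrix r A i M \<Longrightarrow> belt_matrix r A (Suc i) (mutate i M)"
    and "belt_matrix r A (Suc i) M \<Longrightarrow> belt_matrix r A i (mutate i M)"
proof -
  have A_i: "A p i \<le> 0" "A i p \<le> 0" if "p \<in> {1..r}" "p \<noteq> i" for p
    using A[of p i] A[of i p] that i by auto
  {
    fix M assume M: "belt_matrix r A i M"
    have val: "M p q = (if cyclic_rank r i p < cyclic_rank r i q then A p q
      else if cyclic_rank r i p > cyclic_rank r i q then - A p q else 0)"
      if "p \<in> {1..r}" "q \<in> {1..r}" for p q using M that unfolding belt_matrix_def by blast
    have sign: "M p i \<ge> 0" "M i p \<le> 0" if "p \<in> {1..r}" "p \<noteq> i" for p
      using val[of p i] val[of i p] that i A_i[OF that] by (auto simp: cyclic_rank_def)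
    have mut: "mutate i M p q = (if p = i \<or> q = i then - M p q else M p q)"
      if "p \<in> {1..r}" "q \<in> {1..r}" for p q
      using sign[OF that(1)] sign[OF that(2)] by (auto simp: mutate_def max_def)
    show "belt_matrix r A (Suc i) (mutate i M)"
      unfolding belt_matrix_def
    proof (intro ballI)
      fix p q assume pq: "p \<in> {1..r}" "q \<in> {1..r}"
      show "mutate i M p q = (if cyclic_rank r (Suc i) p < cyclic_rank r (Suc i) q then A p q
        else if cyclic_rank r (Suc i) p > cyclic_rank r (Suc i) q then - A p q else 0)"
        unfolding mut[OF pq] val[OF pq] using pq i by (auto simp: cyclic_rank_def less_Suc_eq)
    qed
  }
  {
    fix M assume M: "belt_matrix r A (Suc i) M"
    have val: "M p q = (if cyclic_rank r (Suc i) p < cyclic_rank r (Suc i) q then A p q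
      else if cyclic_rank r (Suc i) p > cyclic_rank r (Suc i) q then - A p q else 0)"
      if "p \<in> {1..r}" "q \<in> {1..r}" for p q using M that unfolding belt_matrix_def by blast
    have sign: "M p i \<le> 0" "M i p \<ge> 0" if "p \<in> {1..r}" "p \<noteq> i" for p
      using val[of p i] val[of i p] that i A_i[OF that] by (auto simp: cyclic_rank_def)
    have mut: "mutate i M p q = (if p = i \<or> q = i then - M p q else M p q)"
      if "p \<in> {1..r}" "q \<in> {1..r}" for p q
      using sign[OF that(1)] sign[OF that(2)] by (auto simp: mutate_def max_def)
    show "belt_matrix r A i (mutate i M)"
      unfolding belt_matrix_def
    proof (intro ballI)
      fix p q assume pq: "p \<in> {1..r}" "q \<in> {1..r}"
      show "mutate i M p q = (if cyclic_rank r i p < cyclic_rank r i q then A p q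
        else if cyclic_rank r i p > cyclic_rank r i q then - A p q else 0)"
        unfolding mut[OF pq] val[OF pq] using pq i by (auto simp: cyclic_rank_def less_Suc_eq)
    qed
  }
qed

lemma B_at_belt:
  assumes A: "symmetrisable_gcm r A" and i: "i \<in> {1..r}"
  shows "belt_matrix r A i (B_at A (belt r i m))"
proof (rule belt_induct[OF i])
  have A_le: "A p q \<le> 0" if "p \<in> {1..r}" "q \<in> {1..r}" "p \<noteq> q" for p q
    using A that unfolding symmetrisable_gcm_def by blast
  have step: "belt_matrix r A i (B_at A s) \<longleftrightarrow> belt_matrix r A (Suc i) (B_at A (neighbour s i))"
    if "i \<in> {1..r}" for i s
    using belt_matrix_mutate[where A = A and r = r, OF A_le that] mutate_mutate[of i "B_at A s"]
    unfolding B_at_neighbour by metis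
  show "belt_matrix r A 1 (B_at A (belt r 1 0))"
    unfolding belt_start by (auto simp: B_init_def belt_matrix_def cyclic_rank_def)
  show "belt_matrix r A i (B_at A (belt r i m)) \<longleftrightarrow> belt_matrix r A (Suc i) (B_at A (belt r (Suc i) m))"
    if "1 \<le> i" "i < r" for i m
    using step[of i "belt r i m"] belt_step[OF that] that by simp
  \<comment> \<open>For the starting point \<open>Suc r\<close> every rank is shifted by
    \<open>r\<close>, so the order is again the natural one.\<close>
  have "belt_matrix r A (Suc r) M \<longleftrightarrow> belt_matrix r A 1 M" for M
    by (simp add: belt_matrix_def cyclic_rank_def)
  then show "belt_matrix r A r (B_at A (belt r r m)) \<longleftrightarrow> belt_matrix r A 1 (B_at A (belt r 1 (m + 1)))" for m
    using step[of r "belt r r m"] belt_wrap[of r m] i by simp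
qed

lemma belt_column:
  assumes "symmetrisable_gcm r A" "i \<in> {1..r}" "j \<in> {1..r}"
  shows "B_at A (belt r i m) j i = (if j = i then 0 else - A j i)"
  using B_at_belt[OF assms(1,2), of m] assms(2,3) unfolding belt_matrix_def
  by (auto simp: cyclic_rank_def)

text \<open>A variable changes only across the edge with its own label. Going forward from
  \<open>belt r i m\<close>, the edge labelled \<open>j\<close> is not crossed before
  \<open>belt r j m\<close> if \<open>i \<le> j\<close>, nor before \<open>belt r j (m + 1)\<close>
  otherwise.\<close>

lemma belt_variable:
  fixes x :: "nat list \<Rightarrow> nat \<Rightarrow> 'a"
  assumes x: "\<And>s k j. s \<in> tree_vertices r \<Longrightarrow> k \<in> {1..r} \<Longrightarrow> j \<in> {1..r} - {k} \<Longrightarrow> x (neighbour s k) j = x s j"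
    and ij: "i \<in> {1..r}" "j \<in> {1..r}"
  shows "x (belt r i m) j = (if i \<le> j then x (belt r j m) j else x (belt r j (m + 1)) j)"
proof -
  have r: "r \<ge> 1" using ij by simp
  have move: "x (belt r (Suc i) m) j = x (belt r i m) j" if "1 \<le> i" "i < r" "i \<noteq> j" for i m
    using x[OF belt_in_tree[OF r, of i m], of i j] belt_step[OF that(1,2), of m] that ij(2) by auto
  \<comment> \<open>The walk from \<open>a\<close> to \<open>b\<close> crosses the edges labelled
    \<open>a\<close> to \<open>b - 1\<close>; the last assumption says that \<open>j\<close> is not
    among them.\<close>
  have const: "x (belt r b m) j = x (belt r a m) j"
    if "1 \<le> a" "a \<le> b" "b \<le> r" "b \<le> j \<or> j < a" for a b m
    using that(2) that(1,3,4)
  proof (induction b rule: dec_induct)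
    case (step b)
    then show ?case using move[of b m] by auto
  qed simp
  show ?thesis
  proof (cases "i \<le> j")
    case True
    then show ?thesis using const[of i j m] ij by simp
  next
    case False
    have "x (belt r i m) j = x (belt r r m) j" using const[of i r m] False ij by simp
    also have "\<dots> = x (belt r 1 (m + 1)) j"
      using x[OF belt_in_tree[OF r, of r m], of r j] belt_wrap[OF r, of m] False ij by simp
    also have "\<dots> = x (belt r j (m + 1)) j" using const[of 1 j "m + 1"] ij by simp
    finally show ?thesis using False by simp
  qed
qed

text \<open>In the product of two consecutive values the factors pair up to products of neighbours
  in a row of \<open>f\<close>, and the frieze relation turns each pair into 1 plus a value of
  \<open>p_map\<close>.\<close>

lemma p_map_YFrieze:
  assumes f: "f \<in> Frieze r A"
  shows "p_map r A f \<in> YFrieze r A"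
proof -
  have pos: "f i m > 0" and eq: "f i m * f i (m + 1) = 1 + p_map r A f i m" if "i \<in> {1..r}" for i m
    using f that by (simp_all add: Frieze_def p_map_def)
  show ?thesis
    unfolding YFrieze_def
  proof (intro CollectI ballI allI conjI)
    fix i m assume i: "i \<in> {1..r}"
    show "0 < p_map r A f i m"
      unfolding p_map_def using i by (intro mult_pos_pos prod_pos zero_less_power pos) auto
    have "p_map r A f i m * p_map r A f i (m + 1) =
      (\<Prod>j\<in>{i<..r}. (f j m * f j (m + 1)) ^ nat (- A j i)) *
      (\<Prod>j\<in>{1..<i}. (f j (m + 1) * f j (m + 1 + 1)) ^ nat (- A j i))"
      by (simp add: p_map_def prod.distrib power_mult_distrib mult_ac)
    also have "(\<Prod>j\<in>{i<..r}. (f j m * f j (m + 1)) ^ nat (- A j i)) =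
        (\<Prod>j\<in>{i<..r}. (1 + p_map r A f j m) ^ nat (- A j i))"
      using i by (intro prod.cong refl) (simp add: eq)
    also have "(\<Prod>j\<in>{1..<i}. (f j (m + 1) * f j (m + 1 + 1)) ^ nat (- A j i)) =
        (\<Prod>j\<in>{1..<i}. (1 + p_map r A f j (m + 1)) ^ nat (- A j i))"
      using i by (intro prod.cong refl) (subst eq, auto)
    finally show "p_map r A f i m * p_map r A f i (m + 1) =
      (\<Prod>j\<in>{i<..r}. (1 + p_map r A f j m) ^ nat (- A j i)) *
      (\<Prod>j\<in>{1..<i}. (1 + p_map r A f j (m + 1)) ^ nat (- A j i))" .
  qed
qed

section \<open>Laurent property and specialisation of the Y-variables\<close>

lemma Y_pattern_mutation:
  assumes "Y_pattern r A y" "t \<in> tree_vertices r" "k \<in> {1..r}"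
  shows "Y_mutation r (B_at A t) k (y t) (y (neighbour t k))"
  using assms unfolding Y_pattern_def Y_mutation_def by blast

lemma Y_pattern_independent:
  assumes "Y_pattern r A y" "t \<in> tree_vertices r"
  shows "algebraically_independent r (y t)"
  using assms unfolding Y_pattern_def free_generators_def by blast

text \<open>The invariant moved along the tree is that \<open>e\<close> is Laurent at a vertex and
  at all its neighbours; \<open>laurent_propagates\<close> consumes and restores it.\<close>

lemma belt_Y_variable_laurent:
  fixes y :: "nat list \<Rightarrow> nat \<Rightarrow> 'b::field_char_0"
  assumes A: "symmetrisable_gcm r A" and y: "Y_pattern r A y"
    and i: "i \<in> {1..r}" and t: "t \<in> tree_vertices r"
  shows "y (belt r i m) i \<in> laurent_ring r (y t)"
proof -
  define b where "b = belt r i m"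
  define e where "e = y b i"
  have r: "r \<ge> 1" using i by simp
  have b: "b \<in> tree_vertices r" unfolding b_def by (rule belt_in_tree[OF r])
  note mut = Y_pattern_mutation[OF y] and indep = Y_pattern_independent[OF y]
  have "e \<in> laurent_ring r (y t) \<and> (\<forall>k\<in>{1..r}. e \<in> laurent_ring r (y (neighbour t k)))"
  proof (rule tree_induct[OF t b])
    have "e \<in> laurent_ring r (y (neighbour b k))" if k: "k \<in> {1..r}" for k
    proof -
      let ?z = "y (neighbour b k)"
      note nb = neighbour_in_tree[OF b k]
      have "Y_mutation r (B_at A (neighbour b k)) k ?z (y b)"
        using mut[OF nb k] by (simp only: neighbour_neighbour[OF b])
      then have m: "y b k = inverse (?z k)"
        "\<And>j. j \<in> {1..r} - {k} \<Longrightarrow> y b j = ?z j * ?z k ^ nat (B_at A (neighbour b k) k j) *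
          (1 + ?z k) powi (- B_at A (neighbour b k) k j)"
        unfolding Y_mutation_def by blast+
      show ?thesis
      proof (cases "k = i")
        case True
        then show ?thesis using m(1) by (simp add: e_def laurent_ring.inv_gen[OF i])
      next
        case False
        \<comment> \<open>Column \<open>i\<close> is nonnegative at the belt, so seen from the
          neighbour \<open>1 + ?z k\<close> has a nonnegative exponent and no denominator
          appears.\<close>
        have "B_at A b i k \<le> 0"
        proof -
          have "B_at A b k i \<ge> 0"
            using belt_column[OF A i k, of m] False A i k unfolding b_def symmetrisable_gcm_def by auto
          then show ?thesis using sign_skewD(2)[OF B_at_sign_skew[OF A b] i k] by linarith
        qed
        then have "B_at A b k i \<ge> 0"
          using sign_skewD(3)[OF B_at_sign_skew[OF A b] k i] by linarith
        then have neg: "B_at A (neighbour b k) k i \<le> 0" by (simp add: B_at_neighbour mutate_def)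
        have "e = ?z i * ?z k ^ nat (B_at A (neighbour b k) k i) * (1 + ?z k) powi (- B_at A (neighbour b k) k i)"
          unfolding e_def using False i by (intro m) auto
        also have "\<dots> = ?z i * (1 + ?z k) ^ nat (- B_at A (neighbour b k) k i)"
          using neg by (simp add: power_int_nonneg_exp)
        also have "\<dots> \<in> laurent_ring r ?z"
          by (intro laurent_ring.mult laurent_power laurent_add laurent_ring.one laurent_ring.gen i k)
        finally show ?thesis .
      qed
    qed
    moreover have "e \<in> laurent_ring r (y b)" unfolding e_def by (rule laurent_ring.gen[OF i])
    ultimately show "e \<in> laurent_ring r (y b) \<and> (\<forall>k\<in>{1..r}. e \<in> laurent_ring r (y (neighbour b k)))"
      by blast
  next
    fix s k assume s: "s \<in> tree_vertices r" and k: "k \<in> {1..r}"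
      and IH: "e \<in> laurent_ring r (y s) \<and> (\<forall>k\<in>{1..r}. e \<in> laurent_ring r (y (neighbour s k)))"
    let ?v = "neighbour s k"
    have v: "?v \<in> tree_vertices r" by (rule neighbour_in_tree[OF s k])
    have s_eq: "neighbour ?v k = s" by (rule neighbour_neighbour[OF s])
    have "e \<in> laurent_ring r (y (neighbour ?v l))" if l: "l \<in> {1..r}" for l
    proof (cases "l = k")
      case True
      then show ?thesis using IH s_eq by simp
    next
      case False
      have w: "neighbour ?v l \<in> tree_vertices r" and u': "neighbour s l \<in> tree_vertices r"
        using neighbour_in_tree v s l by blast+
      \<comment> \<open>The path runs from \<open>s\<close> over \<open>?v\<close> to
        \<open>neighbour ?v l\<close>. The induction hypothesis covers \<open>s\<close> and all its
        neighbours, hence the clusters \<open>u\<close>, \<open>u'\<close> and \<open>v\<close> of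
        the locale.\<close>
      interpret mutation_path r "B_at A ?v" k l "y s" "y (neighbour s l)" "y ?v" "y (neighbour ?v l)"
      proof
        show "Y_mutation r (B_at A ?v) k (y ?v) (y s)" using mut[OF v k] by (simp only: s_eq)
        show "Y_mutation r (mutate l (B_at A ?v)) l (y (neighbour ?v l)) (y ?v)"
          using mut[OF w l] by (simp only: neighbour_neighbour[OF v] B_at_neighbour)
        show "Y_mutation r (mutate k (B_at A ?v)) l (y s) (y (neighbour s l))"
          using mut[OF s l] by (simp only: B_at_neighbour mutate_mutate)
        show "k \<noteq> l" using False by simp
        show "sign_skew r (B_at A ?v)" by (rule B_at_sign_skew[OF A v])
      qed (rule k l indep s v w u')+
      show ?thesis using laurent_propagates[of e] IH k l by blast
    qed
    then show "e \<in> laurent_ring r (y ?v) \<and> (\<forall>l\<in>{1..r}. e \<in> laurent_ring r (y (neighbour ?v l)))"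
      using IH k by blast
  qed
  then show ?thesis unfolding e_def b_def by blast
qed

text \<open>Both patterns are specialised to 1 at the same vertex \<open>t\<close>, where the column
  monomials are 1 too. From there the two mutation rules preserve the relation, and positivity of
  \<open>\<xi>\<close> keeps every division legitimate.\<close>

lemma specialised_variables:
  fixes x :: "nat list \<Rightarrow> nat \<Rightarrow> 'a::field_char_0" and y :: "nat list \<Rightarrow> nat \<Rightarrow> 'b::field_char_0"
  assumes A: "symmetrisable_gcm r A" and x: "A_pattern r A x" and y: "Y_pattern r A y"
    and t: "t \<in> tree_vertices r" and s: "s \<in> tree_vertices r"
    and \<psi>: "unit_specialisation r (x t) \<psi>" and \<phi>: "unit_specialisation r (y t) \<phi>"
  shows "\<exists>\<xi>. \<forall>j\<in>{1..r}. \<xi> j > 0 \<and> specialises_to r (x t) \<psi> (x s j) (\<xi> j) \<and>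
    specialises_to r (y t) \<phi> (y s j) (monomial r \<xi> (\<lambda>i. B_at A s i j))"
proof (rule tree_induct[OF s t])
  show "\<exists>\<xi>. \<forall>j\<in>{1..r}. \<xi> j > 0 \<and> specialises_to r (x t) \<psi> (x t j) (\<xi> j) \<and>
      specialises_to r (y t) \<phi> (y t j) (monomial r \<xi> (\<lambda>i. B_at A t i j))"
    using specialises_to_gen[OF \<psi>] specialises_to_gen[OF \<phi>]
    by (intro exI[of _ "\<lambda>_. 1"]) (simp add: monomial_def)
next
  fix s k assume s: "s \<in> tree_vertices r" and k: "k \<in> {1..r}"
    and "\<exists>\<xi>. \<forall>j\<in>{1..r}. \<xi> j > 0 \<and> specialises_to r (x t) \<psi> (x s j) (\<xi> j) \<and>
      specialises_to r (y t) \<phi> (y s j) (monomial r \<xi> (\<lambda>i. B_at A s i j))"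
  then obtain \<xi> where pos: "\<And>j. j \<in> {1..r} \<Longrightarrow> \<xi> j > 0"
    and \<xi>: "\<And>j. j \<in> {1..r} \<Longrightarrow> specialises_to r (x t) \<psi> (x s j) (\<xi> j)"
    and \<eta>: "\<And>j. j \<in> {1..r} \<Longrightarrow> specialises_to r (y t) \<phi> (y s j) (monomial r \<xi> (\<lambda>i. B_at A s i j))"
    by blast
  define B where "B = B_at A s"
  define \<eta>k where "\<eta>k = monomial r \<xi> (\<lambda>i. B i k)"
  define \<xi>' where "\<xi>' = \<xi>(k := ((\<Prod>i\<in>{1..r}. \<xi> i ^ nat (B i k)) + (\<Prod>i\<in>{1..r}. \<xi> i ^ nat (- B i k))) / \<xi> k)"
  have Bkk: "B k k = 0" unfolding B_def by (rule sign_skewD(1)[OF B_at_sign_skew[OF A s] k k])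
  have \<eta>k_pos: "\<eta>k > 0" unfolding \<eta>k_def monomial_def using pos by (intro prod_pos) auto
  have \<eta>': "monomial r \<xi>' (\<lambda>i. mutate k B i k) = inverse \<eta>k"
    "j \<noteq> k \<Longrightarrow> monomial r \<xi>' (\<lambda>i. mutate k B i j) =
      monomial r \<xi> (\<lambda>i. B i j) * \<eta>k ^ nat (B k j) * (1 + \<eta>k) powi (- B k j)" for j
    unfolding \<xi>'_def \<eta>k_def using pos k Bkk by (rule column_monomials_mutate; blast)+
  have x': "x (neighbour s k) k = ((\<Prod>i\<in>{1..r}. x s i ^ nat (B i k)) + (\<Prod>i\<in>{1..r}. x s i ^ nat (- B i k))) / x s k"
    "j \<in> {1..r} - {k} \<Longrightarrow> x (neighbour s k) j = x s j" for j
    using x s k unfolding A_pattern_def B_def by blast+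
  have y': "y (neighbour s k) k = inverse (y s k)"
    "j \<in> {1..r} - {k} \<Longrightarrow> y (neighbour s k) j = y s j * y s k ^ nat (B k j) * (1 + y s k) powi (- B k j)" for j
    using Y_pattern_mutation[OF y s k] unfolding Y_mutation_def B_def by blast+
  have num_pos: "(\<Prod>i\<in>{1..r}. \<xi> i ^ nat (B i k)) + (\<Prod>i\<in>{1..r}. \<xi> i ^ nat (- B i k)) > 0"
    using pos by (intro add_pos_pos prod_pos) auto
  have "\<xi>' j > 0 \<and> specialises_to r (x t) \<psi> (x (neighbour s k) j) (\<xi>' j) \<and>
      specialises_to r (y t) \<phi> (y (neighbour s k) j) (monomial r \<xi>' (\<lambda>i. B_at A (neighbour s k) i j))"
    if j: "j \<in> {1..r}" for j
  proof (cases "j = k")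
    case True
    have "specialises_to r (x t) \<psi> (x (neighbour s k) k) (\<xi>' k)"
      unfolding x' \<xi>'_def fun_upd_same divide_inverse
      by (intro specialises_to_mult[OF \<psi>] specialises_to_add[OF \<psi>] specialises_to_prod[OF \<psi>]
          specialises_to_power[OF \<psi>] specialises_to_inverse[OF \<psi>] \<xi> k)
        (use pos[OF k] in simp_all)
    moreover have "specialises_to r (y t) \<phi> (inverse (y s k)) (inverse \<eta>k)"
      using \<eta>[OF k] \<eta>k_pos by (intro specialises_to_inverse[OF \<phi>]) (simp_all add: \<eta>k_def B_def)
    moreover have "\<xi>' k > 0" unfolding \<xi>'_def fun_upd_same by (intro divide_pos_pos num_pos pos k)
    ultimately show ?thesis
      unfolding True B_at_neighbour B_def[symmetric] \<eta>'(1) y'(1) by blast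
  next
    case False
    have "specialises_to r (y t) \<phi> (y s j * y s k ^ nat (B k j) * (1 + y s k) powi (- B k j))
        (monomial r \<xi> (\<lambda>i. B i j) * \<eta>k ^ nat (B k j) * (1 + \<eta>k) powi (- B k j))"
      unfolding B_def \<eta>k_def
      by (intro specialises_to_mult[OF \<phi>] specialises_to_power[OF \<phi>] specialises_to_powi[OF \<phi>]
          specialises_to_add[OF \<phi>] specialises_to_one[OF \<phi>] \<eta> k j)
        (use \<eta>k_pos in \<open>simp add: \<eta>k_def B_def\<close>)
    then show ?thesis using False j pos[OF j] \<xi>[OF j] x'(2)[of j] y'(2)[of j]
      by (simp add: B_at_neighbour \<eta>'(2) B_def[symmetric]) (simp add: \<xi>'_def)
  qed
  then show "\<exists>\<xi>. \<forall>j\<in>{1..r}. \<xi> j > 0 \<and> specialises_to r (x t) \<psi> (x (neighbour s k) j) (\<xi> j) \<and>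
      specialises_to r (y t) \<phi> (y (neighbour s k) j) (monomial r \<xi> (\<lambda>i. B_at A (neighbour s k) i j))"
    by blast
qed

lemma prod_split_at:
  fixes g :: "nat \<Rightarrow> 'a::comm_monoid_mult"
  assumes "i \<in> {1..r}"
  shows "prod g {1..r} = g i * (prod g {i<..r} * prod g {1..<i})"
proof -
  have "{1..r} = insert i ({i<..r} \<union> {1..<i})" using assms by auto
  moreover have "prod g (insert i ({i<..r} \<union> {1..<i})) = g i * prod g ({i<..r} \<union> {1..<i})"
    by (rule prod.insert) auto
  moreover have "prod g ({i<..r} \<union> {1..<i}) = prod g {i<..r} * prod g {1..<i}"
    by (rule prod.union_disjoint) auto
  ultimately show ?thesis by simp
qed

theorem theorem2p15:
  fixes r :: nat
    and A :: "nat \<Rightarrow> nat \<Rightarrow> int"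
    and x :: "nat list \<Rightarrow> nat \<Rightarrow> 'a::field_char_0"
    and y :: "nat list \<Rightarrow> nat \<Rightarrow> 'b::field_char_0"
    and f :: "nat \<Rightarrow> int \<Rightarrow> int"
  assumes "symmetrisable_gcm r A"
    and "A_pattern r A x"
    and "Y_pattern r A y"
    and "f \<in> Frieze r A"
    and "unitary r x f"
  shows "p_map r A f \<in> YFrieze r A \<and> unitary r y (p_map r A f)"
proof
  note A = assms(1) and x = assms(2) and y = assms(3)
  show "p_map r A f \<in> YFrieze r A" by (rule p_map_YFrieze[OF assms(4)])
  obtain t \<psi> where t: "t \<in> tree_vertices r" and \<psi>: "unit_specialisation r (x t) \<psi>"
    and lx: "\<And>i m. i \<in> {1..r} \<Longrightarrow> x (belt r i m) i \<in> laurent_ring r (x t)"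
    and f: "\<And>i m. i \<in> {1..r} \<Longrightarrow> f i m = \<psi> (x (belt r i m) i)"
    using assms(5) unfolding unitary_def by blast
  \<comment> \<open>The vertex \<open>t\<close> whose cluster witnesses unitarity of
    \<open>f\<close> also supplies the Y-cluster for \<open>p_map\<close>.\<close>
  obtain \<phi> where \<phi>: "unit_specialisation r (y t) \<phi>"
    using unit_specialisation_exists[OF Y_pattern_independent[OF y t]] by blast
  have ly: "y (belt r i m) i \<in> laurent_ring r (y t)" if "i \<in> {1..r}" for i m
    by (rule belt_Y_variable_laurent[OF A y that t])
  have "p_map r A f i m = \<phi> (y (belt r i m) i)" if i: "i \<in> {1..r}" for i m
  proof -
    let ?s = "belt r i m"
    have s: "?s \<in> tree_vertices r" using i by (intro belt_in_tree) simp
    obtain \<xi> where pos: "\<And>j. j \<in> {1..r} \<Longrightarrow> \<xi> j > 0"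
      and \<xi>: "\<And>j. j \<in> {1..r} \<Longrightarrow> specialises_to r (x t) \<psi> (x ?s j) (\<xi> j)"
      and \<eta>: "specialises_to r (y t) \<phi> (y ?s i) (monomial r \<xi> (\<lambda>j. B_at A ?s j i))"
      using specialised_variables[OF A x y t s \<psi> \<phi>] i by blast
    have x_const: "x (neighbour s k) j = x s j"
      if "s \<in> tree_vertices r" "k \<in> {1..r}" "j \<in> {1..r} - {k}" for s k j
      using x that unfolding A_pattern_def by blast
    \<comment> \<open>At \<open>belt r i m\<close> the variables with index at least
      \<open>i\<close> carry second index \<open>m\<close> and the earlier ones
      \<open>m + 1\<close>, the same split as in \<open>p_map\<close>.\<close>
    have \<xi>_eq: "\<xi> j = of_int (if i \<le> j then f j m else f j (m + 1))" if j: "j \<in> {1..r}" for j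
    proof (cases "i \<le> j")
      case True
      then have "x ?s j = x (belt r j m) j" using belt_variable[where x = x, OF x_const i j, of m] by simp
      then show ?thesis using specialises_to_unique[OF \<psi> \<xi>[OF j]] lx[OF j] f[OF j] True by simp
    next
      case False
      then have "x ?s j = x (belt r j (m + 1)) j" using belt_variable[where x = x, OF x_const i j, of m] by simp
      then show ?thesis using specialises_to_unique[OF \<psi> \<xi>[OF j]] lx[OF j] f[OF j] False by simp
    qed
    let ?g = "\<lambda>j. \<xi> j powi B_at A ?s j i"
    have A_le: "A j i \<le> 0" if "j \<in> {1..r}" "j \<noteq> i" for j
      using A i that unfolding symmetrisable_gcm_def by blast
    have "?g i = 1" using belt_column[OF A i i] by simp
    moreover have "prod ?g {i<..r} = (\<Prod>j\<in>{i<..r}. of_int (f j m ^ nat (- A j i)))"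
      using i A_le \<xi>_eq belt_column[OF A i, of _ m]
      by (intro prod.cong refl) (simp add: power_int_nonneg_exp)
    moreover have "prod ?g {1..<i} = (\<Prod>j\<in>{1..<i}. of_int (f j (m + 1) ^ nat (- A j i)))"
      using i A_le \<xi>_eq belt_column[OF A i, of _ m]
      by (intro prod.cong refl) (simp add: power_int_nonneg_exp)
    ultimately have "monomial r \<xi> (\<lambda>j. B_at A ?s j i) = of_int (p_map r A f i m)"
      unfolding monomial_def prod_split_at[OF i] p_map_def by (simp only: of_int_mult of_int_prod mult_1_left)
    then show ?thesis using specialises_to_unique[OF \<phi> \<eta> ly[OF i]] by simp
  qed
  then show "unitary r y (p_map r A f)" unfolding unitary_def using t \<phi> ly by blast
qed

end
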